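(* Let $L>0$, $d\in\{1,2,3\}$, and let $\boldsymbol\gamma=(\gamma_1,\dots,\gamma_d)$ with $\gamma_1=1$ and $0<\gamma_j\le1$ for $j=2,\dots,d$. Let the density $\rho$ be compactly supported in $\mathbf{R}_L^{\boldsymbol\gamma}=\prod_{j=1}^d[-L\gamma_j,L\gamma_j]$, which is also the domain where the potential $\Phi=U\ast\rho$ is wanted, and put $G=2L\sqrt{1+\gamma_2^2+\cdots+\gamma_d^2}$. To evaluate $\Phi$ on $\mathbf{R}_L^{\boldsymbol\gamma}$ by the kernel truncation method, $\rho$ must be approximated on $$\widetilde{\mathbf{R}}=\{\mathbf{z}\in\mathbb{R}^d:\ |z_j|\le G+L\gamma_j,\ j=1,\dots,d\}.$$ Apply the Fourier spectral method on $\prod_{j=1}^d[-S_jL\gamma_j,S_jL\gamma_j]$, where $S_j\ge1$ is the zero-padding factor in the $j$-th direction, so as to obtain a spectral approximation of $\rho$ on $\widetilde{\mathbf{R}}$. Once the condition $$G+L\gamma_j\le(2S_j-1)L\gamma_j,\qquad\text{i.e.}\qquad 1+\gamma_j^{-1}\sqrt{1+\gamma_2^2+\cdots+\gamma_d^2}\le S_j,$$ is satisfied, one derives the optimal zero-padding factors $$S_j=1+\gamma_j^{-1}\sqrt{1+\gamma_2^2+\cdots+\gamma_d^2},\qquad j=1,\dots,d.$$ These reduce to $S_j=\sqrt d+1$ when the anisotropy strength $\gamma_f:=\prod_{j=1}^d\gamma_j^{-1}$ equals one. In practice the optimal factor along the $j$-th direction is $\lceil S_j\rceil$, and the minimum memory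 cost is $\prod_{j=1}^d\lceil S_j\rceil$ times that of the original density.
   Context: The nonlocal potential is $\Phi(\mathbf{x})=\int_{\mathbb{R}^d}U(\mathbf{x}-\mathbf{y})\rho(\mathbf{y})\,d\mathbf{y}$, with $\rho$ smooth and the kernel $U$ possibly singular at the origin and/or at the far field. $G$ is the diameter of $\mathbf{R}_L^{\boldsymbol\gamma}$ (for $d=1$ the square root equals $1$). The kernel truncation method is based on $\Phi(\mathbf{x})=\int_{\mathbf{B}_G}U(\mathbf{y})\rho(\mathbf{x}-\mathbf{y})\,d\mathbf{y}$ for $\mathbf{x}\in\mathbf{R}_L^{\boldsymbol\gamma}$, where $\mathbf{B}_G$ is the ball of radius $G$ centered at the origin, with $\rho$ replaced by a finite Fourier series; $\widetilde{\mathbf{R}}$ contains all $\mathbf{x}-\mathbf{y}$ with $\mathbf{x}\in\mathbf{R}_L^{\boldsymbol\gamma}$, $\mathbf{y}\in\mathbf{B}_G$. Zero-padding means that $\rho$ is extended by zero from $\mathbf{R}_L^{\boldsymbol\gamma}$ to $\prod_{j=1}^d[-S_jL\gamma_j,S_jL\gamma_j]$; the finite Fourier series on the padded box has period $2S_jL\gamma_j$ in the $j$-th direction and is thereby extended periodically to $\mathbb{R}^d$. The density is sampled on a uniform grid with the same number of points in each direction, and "spectral approximation" means approximation with spectral accuracy in that number. $\lceil\cdot\rceil$ denotes rounding up to the nearest integer. *)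

theory Defs
  imports "HOL-Analysis.Analysis"
begin

section \<open>Boxes and radii\<close>

text \<open>Coordinates are indexed by a finite type \<open>'d\<close>, so \<open>d = CARD('d)\<close>; \<open>j1 :: 'd\<close> plays the role of
  the index \<open>1\<close>, the direction with \<open>\<gamma> $ j1 = 1\<close>.\<close>

definition density_box :: "real \<Rightarrow> real^'d \<Rightarrow> (real^'d) set" where
  "density_box L \<gamma> = {x. \<forall>j. \<bar>x $ j\<bar> \<le> L * \<gamma> $ j}"

definition aniso_root :: "real^'d \<Rightarrow> 'd \<Rightarrow> real" where
  "aniso_root \<gamma> j1 = sqrt (1 + (\<Sum>j\<in>UNIV - {j1}. (\<gamma> $ j)\<^sup>2))"

definition trunc_radius :: "real \<Rightarrow> real^'d \<Rightarrow> 'd \<Rightarrow> real" where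
  "trunc_radius L \<gamma> j1 = 2 * L * aniso_root \<gamma> j1"

definition extended_box :: "real \<Rightarrow> real^'d \<Rightarrow> 'd \<Rightarrow> (real^'d) set" where
  "extended_box L \<gamma> j1 = {z. \<forall>j. \<bar>z $ j\<bar> \<le> trunc_radius L \<gamma> j1 + L * \<gamma> $ j}"

definition aniso_strength :: "real^'d \<Rightarrow> real" where
  "aniso_strength \<gamma> = (\<Prod>j\<in>UNIV. inverse (\<gamma> $ j))"


section \<open>Densities and potentials\<close>

primrec Ck :: "nat \<Rightarrow> ('a::real_normed_vector \<Rightarrow> 'b::real_normed_vector) \<Rightarrow> bool" where
  "Ck 0 f \<longleftrightarrow> continuous_on UNIV f"
| "Ck (Suc k) f \<longleftrightarrow> (\<forall>x. f differentiable (at x)) \<and>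
     (\<forall>v. Ck k (\<lambda>x. frechet_derivative f (at x) v))"

definition smooth :: "('a::real_normed_vector \<Rightarrow> 'b::real_normed_vector) \<Rightarrow> bool" where
  "smooth f \<longleftrightarrow> (\<forall>k. Ck k f)"

definition densities :: "real \<Rightarrow> real^'d \<Rightarrow> (real^'d \<Rightarrow> real) set" where
  "densities L \<gamma> = {\<rho>. smooth \<rho> \<and> compact (closure {x. \<rho> x \<noteq> 0}) \<and>
     closure {x. \<rho> x \<noteq> 0} \<subseteq> density_box L \<gamma>}"

definition potential :: "(real^'d \<Rightarrow> real) \<Rightarrow> (real^'d \<Rightarrow> real) \<Rightarrow> real^'d \<Rightarrow> real" where
  "potential U \<rho> x = (LINT y|lborel. U (x - y) * \<rho> y)"

definition truncated_potential ::
    "real \<Rightarrow> (real^'d \<Rightarrow> real) \<Rightarrow> (real^'d \<Rightarrow> real) \<Rightarrow> real^'d \<Rightarrow> real" where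
  "truncated_potential G U \<rho> x = (LINT y:cball 0 G|lborel. U y * \<rho> (x - y))"


section \<open>The zero-padded Fourier spectral method\<close>

definition zero_extension :: "real \<Rightarrow> real^'d \<Rightarrow> (real^'d \<Rightarrow> real) \<Rightarrow> real^'d \<Rightarrow> real" where
  "zero_extension L \<gamma> \<rho> x = (if x \<in> density_box L \<gamma> then \<rho> x else 0)"

text \<open>The density is resolved by \<open>n\<close> grid points per direction on its own box. The padded box
  is \<open>S $ j\<close> times as wide in direction \<open>j\<close> and keeps this resolution; its number of points is
  rounded up because \<open>S $ j\<close> may be any real number \<open>\<ge> 1\<close>. For integral \<open>S $ j\<close> the mesh size
  is exactly that of the density grid.\<close>

definition num_points :: "real^'d \<Rightarrow> nat \<Rightarrow> 'd \<Rightarrow> nat" where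
  "num_points S n j = nat \<lceil>S $ j * real n\<rceil>"

definition grid_indices :: "real^'d \<Rightarrow> nat \<Rightarrow> ('d \<Rightarrow> nat) set" where
  "grid_indices S n = {p. \<forall>j. p j < num_points S n j}"

definition grid_point :: "real \<Rightarrow> real^'d \<Rightarrow> real^'d \<Rightarrow> nat \<Rightarrow> ('d \<Rightarrow> nat) \<Rightarrow> real^'d" where
  "grid_point L \<gamma> S n p =
     (\<chi> j. - (S $ j * L * \<gamma> $ j) + 2 * S $ j * L * \<gamma> $ j * real (p j) / real (num_points S n j))"

definition grid :: "real \<Rightarrow> real^'d \<Rightarrow> real^'d \<Rightarrow> nat \<Rightarrow> (real^'d) set" where
  "grid L \<gamma> S n = grid_point L \<gamma> S n ` grid_indices S n"

text \<open>For an even number \<open>M\<close> of points these are the frequencies \<open>-M/2, \<dots>, M/2 - 1\<close>.\<close>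

definition frequencies :: "real^'d \<Rightarrow> nat \<Rightarrow> ('d \<Rightarrow> int) set" where
  "frequencies S n = {k. \<forall>j. - int (num_points S n j div 2) \<le> k j \<and>
     k j < int (num_points S n j) - int (num_points S n j div 2)}"

definition fourier_mode :: "real \<Rightarrow> real^'d \<Rightarrow> real^'d \<Rightarrow> ('d \<Rightarrow> int) \<Rightarrow> real^'d \<Rightarrow> complex" where
  "fourier_mode L \<gamma> S k z =
     cis (\<Sum>j\<in>UNIV. 2 * pi * real_of_int (k j) * z $ j / (2 * S $ j * L * \<gamma> $ j))"

definition fourier_coeff ::
    "real \<Rightarrow> real^'d \<Rightarrow> real^'d \<Rightarrow> nat \<Rightarrow> (real^'d \<Rightarrow> real) \<Rightarrow> ('d \<Rightarrow> int) \<Rightarrow> complex" where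
  "fourier_coeff L \<gamma> S n \<rho> k =
     (\<Sum>p\<in>grid_indices S n. of_real (zero_extension L \<gamma> \<rho> (grid_point L \<gamma> S n p)) *
        cnj (fourier_mode L \<gamma> S k (grid_point L \<gamma> S n p)))
     / of_nat (\<Prod>j\<in>UNIV. num_points S n j)"

definition fourier_series ::
    "real \<Rightarrow> real^'d \<Rightarrow> real^'d \<Rightarrow> nat \<Rightarrow> (real^'d \<Rightarrow> real) \<Rightarrow> real^'d \<Rightarrow> complex" where
  "fourier_series L \<gamma> S n \<rho> z =
     (\<Sum>k\<in>frequencies S n. fourier_coeff L \<gamma> S n \<rho> k * fourier_mode L \<gamma> S k z)"

definition spectrally_accurate_on ::
    "'a set \<Rightarrow> (nat \<Rightarrow> 'a \<Rightarrow> complex) \<Rightarrow> ('a \<Rightarrow> real) \<Rightarrow> bool" where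
  "spectrally_accurate_on D f g \<longleftrightarrow>
     (\<forall>m::nat. \<exists>C::real. \<forall>n\<ge>1. \<forall>z\<in>D. norm (f n z - of_real (g z)) \<le> C / real n ^ m)"


section \<open>Admissible and optimal zero-padding factors\<close>

definition admissible_paddings :: "real \<Rightarrow> real^'d \<Rightarrow> 'd \<Rightarrow> (real^'d) set" where
  "admissible_paddings L \<gamma> j1 = {S. (\<forall>j. S $ j \<ge> 1) \<and>
     (\<forall>\<rho>\<in>densities L \<gamma>.
        spectrally_accurate_on (extended_box L \<gamma> j1) (\<lambda>n. fourier_series L \<gamma> S n \<rho>) \<rho>)}"

definition integral_paddings :: "(real^'d) set" where
  "integral_paddings = {S. \<forall>j. S $ j \<in> \<int>}"

text \<open>Optimality is meant in every direction simultaneously, not only for a product of factors.\<close>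

definition is_optimal_in :: "(real^'d) set \<Rightarrow> real^'d \<Rightarrow> bool" where
  "is_optimal_in A S \<longleftrightarrow> S \<in> A \<and> (\<forall>T\<in>A. \<forall>j. S $ j \<le> T $ j)"

definition opt_padding :: "real^'d \<Rightarrow> 'd \<Rightarrow> real^'d" where
  "opt_padding \<gamma> j1 = (\<chi> j. 1 + inverse (\<gamma> $ j) * aniso_root \<gamma> j1)"

definition ceil_padding :: "real^'d \<Rightarrow> 'd \<Rightarrow> real^'d" where
  "ceil_padding \<gamma> j1 = (\<chi> j. of_int \<lceil>opt_padding \<gamma> j1 $ j\<rceil>)"

text \<open>Memory is counted in stored grid values; the original density is the unpadded case
  \<open>S = 1\<close>.\<close>

definition memory_cost :: "real \<Rightarrow> real^'d \<Rightarrow> real^'d \<Rightarrow> nat \<Rightarrow> nat" where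
  "memory_cost L \<gamma> S n = card (grid L \<gamma> S n)"

end

theory Submission
  imports Defs
begin

text \<open>
  The only analytic point is that the padding condition is equivalent to spectral accuracy.

  If the condition holds, the periodic copies of the density do not meet the extended box, so it is
  enough to interpolate on one period. In one dimension, \<open>m\<close>-fold summation by parts bounds the
  discrete Fourier coefficients on every grid by \<open>C / |l|\<^sup>m\<close>. The interpolant on \<open>M\<close> points is
  compared with the one on \<open>K * M\<close> points, which is exact on its own grid: they differ only through
  coefficients with \<open>|l| \<ge> M/2\<close>, uniformly in \<open>K\<close>, and the grids become dense. No Fourier
  integrals or infinite series are needed. Tensorization costs only powers of the number of points.

  If the condition fails in some direction, some point inside the density box has a translate by
  one period inside the extended box, where periodicity of the series contradicts convergence.
\<close>

section \<open>Trigonometric interpolation in one variable\<close>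

text \<open>The coefficients of the series are sums over grid samples, so the series is an
  interpolant and aliasing has to be controlled along with truncation. What is required is a
  coefficient bound that survives arbitrary refinement of the grid. Differencing the samples
  provides it: each difference gains the mesh size \<open>h\<close>, and dividing by
  \<open>cis (- \<theta>) - 1\<close>, which is of order |l| / N, leaves a multiple of P / |l|
  because \<open>h\<close> is P / N. The number (2 S_j - 1) L \<gamma>_j is the period 2 S_j L
  \<gamma>_j minus the half-width L \<gamma>_j: the distance at which the neighbouring copy of the
  density box begins in direction j. Equality is allowed because a continuous density supported in
  the closed box vanishes on its faces. The order of differentiation is fixed by what is lost on the
  way: two derivatives make the coefficient tail summable, one power of the number of points goes to
  the interpolation operator in one variable, and d powers to the tensor product.\<close>

definition trig_mode :: "real \<Rightarrow> int \<Rightarrow> real \<Rightarrow> complex" where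
  "trig_mode P k t = cis (2 * pi * of_int k * t / P)"

definition node :: "real \<Rightarrow> nat \<Rightarrow> real \<Rightarrow> real" where
  "node P M s = - (P / 2) + P * s / of_nat M"

text \<open>One direction of \<open>frequencies\<close>. Members satisfy 2 |l| \<le> M and
  non-members 2 |l| \<ge> M. For even \<open>M\<close> the frequency -M/2 has no partner, so the
  interpolant of real data may be complex.\<close>

definition freqs :: "nat \<Rightarrow> int set" where
  "freqs M = {- int (M div 2)..<int M - int (M div 2)}"

text \<open>The Dirichlet kernel centred at node \<open>p\<close> and divided by \<open>M\<close>:
  the Lagrange basis function of that node.\<close>

definition cardinal_fun :: "real \<Rightarrow> nat \<Rightarrow> nat \<Rightarrow> real \<Rightarrow> complex" where
  "cardinal_fun P M p t = (\<Sum>k\<in>freqs M. trig_mode P k (t - node P M (real p))) / of_nat M"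

definition trig_interp :: "real \<Rightarrow> nat \<Rightarrow> (real \<Rightarrow> complex) \<Rightarrow> real \<Rightarrow> complex" where
  "trig_interp P M u t = (\<Sum>p<M. u (node P M (real p)) * cardinal_fun P M p t)"

definition dft_coeff :: "real \<Rightarrow> nat \<Rightarrow> (real \<Rightarrow> complex) \<Rightarrow> int \<Rightarrow> complex" where
  "dft_coeff P M u l = (\<Sum>p<M. u (node P M (real p)) * trig_mode P (- l) (node P M (real p))) / of_nat M"

lemma finite_freqs [simp]: "finite (freqs M)"
  by (simp add: freqs_def)

lemma card_freqs [simp]: "card (freqs M) = M"
  by (simp add: freqs_def)

lemma norm_trig_mode [simp]: "norm (trig_mode P k t) = 1"
  by (simp add: trig_mode_def)

lemma trig_mode_diff: "trig_mode P k (s - t) = trig_mode P k s * trig_mode P (- k) t"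
  by (simp add: trig_mode_def cis_mult diff_divide_distrib right_diff_distrib)

lemma trig_mode_freq_diff: "trig_mode P (k - l) t = trig_mode P k t * trig_mode P (- l) t"
  by (simp add: trig_mode_def cis_mult diff_divide_distrib left_diff_distrib right_diff_distrib)

lemma cnj_trig_mode: "cnj (trig_mode P k t) = trig_mode P (- k) t"
  by (simp add: trig_mode_def cis_cnj)

lemma trig_mode_period:
  assumes "P \<noteq> 0"
  shows "trig_mode P k (t + P) = trig_mode P k t"
proof -
  have "2 * pi * of_int k * (t + P) / P = 2 * pi * of_int k * t / P + 2 * pi * of_int k"
    using assms by (simp add: field_simps)
  then show ?thesis
    using cis_multiple_2pi[of "of_int k"] by (simp add: trig_mode_def flip: cis_mult)
qed

text \<open>There are \<open>M\<close> terms of modulus one, divided by \<open>M\<close>. Summed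
  over the nodes this yields the Lebesgue constant \<open>M\<close>, far above the logarithmic truth
  but polynomial.\<close>

lemma norm_cardinal_fun_le: "norm (cardinal_fun P M p t) \<le> 1"
proof -
  have "norm (\<Sum>k\<in>freqs M. trig_mode P k (t - node P M (real p))) \<le> (\<Sum>k\<in>freqs M. 1)"
    by (rule sum_norm_le) simp
  then show ?thesis
    by (simp add: cardinal_fun_def norm_divide divide_le_eq)
qed

section \<open>Discrete orthogonality of the modes\<close>

lemma sum_root_of_unity:
  assumes "M > 0"
  shows "(\<Sum>p<M. cis (2 * pi * of_int q * real p / real M)) = (if int M dvd q then of_nat M else 0)"
proof -
  define w where "w = cis (2 * pi * of_int q / real M)"
  have pow: "w ^ p = cis (2 * pi * of_int q * real p / real M)" for p
    by (simp add: w_def Complex.DeMoivre mult_ac)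
  have wM: "w ^ M = 1"
    using assms cis_multiple_2pi[of "of_int q"] by (simp add: pow)
  have w1: "w = 1 \<longleftrightarrow> int M dvd q"
  proof
    assume "w = 1"
    then have "cos (2 * pi * of_int q / real M) = 1"
      by (metis w_def cis.sel(1) one_complex.sel(1))
    then obtain n :: int where n: "2 * pi * of_int q / real M = of_int n * 2 * pi"
      using cos_one_2pi_int by blast
    then have "real_of_int q = of_int n * real M"
      using assms by (simp add: field_simps)
    then have "q = n * int M"
      by (metis of_int_eq_iff of_int_mult of_int_of_nat_eq)
    then show "int M dvd q" by simp
  next
    assume "int M dvd q"
    then obtain n where "q = int M * n" by blast
    then have "2 * pi * of_int q / real M = 2 * pi * of_int n"
      using assms by simp
    then show "w = 1"
      using cis_multiple_2pi[of "of_int n"] by (simp add: w_def)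
  qed
  have "(\<Sum>p<M. w ^ p) = (if w = 1 then of_nat M else 0)"
    by (simp add: geometric_sum wM)
  then show ?thesis by (simp add: pow w1)
qed

lemma sum_freqs_root_of_unity:
  assumes "M > 0"
  shows "(\<Sum>k\<in>freqs M. cis (2 * pi * of_int q * of_int k / real M)) = (if int M dvd q then of_nat M else 0)"
proof -
  define b where "b = - int (M div 2)"
  have "(\<Sum>k\<in>freqs M. cis (2 * pi * of_int q * of_int k / real M))
      = (\<Sum>p<M. cis (2 * pi * of_int q * of_int (b + int p) / real M))"
    by (rule sum.reindex_bij_witness[where i = "\<lambda>p. b + int p" and j = "\<lambda>k. nat (k - b)"])
       (auto simp: freqs_def b_def)
  also have "\<dots> = cis (2 * pi * of_int q * of_int b / real M) *
      (\<Sum>p<M. cis (2 * pi * of_int q * real p / real M))"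
    by (simp add: sum_distrib_left cis_mult distrib_left add_divide_distrib)
  \<comment> \<open>Moving the frequency window by \<open>b\<close> only multiplies the sum by a
    phase, and that phase is 1 whenever the sum is nonzero.\<close>
  also have "\<dots> = (if int M dvd q then of_nat M else 0)"
  proof (cases "int M dvd q")
    case True
    then obtain n where "q = int M * n" by blast
    then have "2 * pi * of_int q * of_int b / real M = 2 * pi * of_int (n * b)"
      using assms by simp
    then have "cis (2 * pi * of_int q * of_int b / real M) = 1"
      by (metis cis_multiple_2pi Ints_of_int)
    with True show ?thesis using sum_root_of_unity[OF assms] by simp
  qed (use sum_root_of_unity[OF assms] in simp)
  finally show ?thesis .
qed

lemma cardinal_fun_node:
  assumes "M > 0" "P \<noteq> 0" "p < M" "q < M"
  shows "cardinal_fun P M p (node P M (real q)) = (if p = q then 1 else 0)"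
proof -
  have "trig_mode P k (node P M (real q) - node P M (real p)) =
     cis (2 * pi * of_int (int q - int p) * of_int k / real M)" for k
  proof -
    have "node P M (real q) - node P M (real p) = P * of_int (int q - int p) / real M"
      by (simp add: node_def diff_divide_distrib right_diff_distrib)
    then show ?thesis
      using assms by (simp add: trig_mode_def mult_ac)
  qed
  then have "cardinal_fun P M p (node P M (real q)) = (if int M dvd int q - int p then 1 else 0)"
    using assms sum_freqs_root_of_unity[of M "int q - int p"] by (simp add: cardinal_fun_def)
  moreover have "int M dvd int q - int p \<longleftrightarrow> p = q"
  proof
    assume "int M dvd int q - int p"
    moreover have "\<bar>int q - int p\<bar> < int M"
      using assms by auto
    ultimately show "p = q"
      using dvd_imp_le_int[of "int q - int p" "int M"] by auto
  qed simp
  ultimately show ?thesis by simp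
qed

lemma trig_interp_node:
  assumes "M > 0" "P \<noteq> 0" "q < M"
  shows "trig_interp P M u (node P M (real q)) = u (node P M (real q))"
proof -
  have "trig_interp P M u (node P M (real q)) = (\<Sum>p<M. if p = q then u (node P M (real p)) else 0)"
    unfolding trig_interp_def by (rule sum.cong) (use assms in \<open>auto simp: cardinal_fun_node\<close>)
  then show ?thesis using assms by (simp add: sum.delta')
qed

lemma trig_interp_dft:
  "trig_interp P M u t = (\<Sum>l\<in>freqs M. dft_coeff P M u l * trig_mode P l t)"
proof -
  have "trig_interp P M u t = (\<Sum>p<M. \<Sum>l\<in>freqs M.
      u (node P M (real p)) * trig_mode P (- l) (node P M (real p)) / of_nat M * trig_mode P l t)"
    by (simp add: trig_interp_def cardinal_fun_def trig_mode_diff sum_distrib_left sum_divide_distrib mult_ac)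
  also have "\<dots> = (\<Sum>l\<in>freqs M. \<Sum>p<M.
      u (node P M (real p)) * trig_mode P (- l) (node P M (real p)) / of_nat M * trig_mode P l t)"
    by (rule sum.swap)
  finally show ?thesis
    by (simp add: dft_coeff_def sum_distrib_right sum_divide_distrib)
qed

lemma dft_coeff_trig_mode:
  assumes "M > 0" "P \<noteq> 0" "l \<in> freqs M" "k \<in> freqs M"
  shows "dft_coeff P M (trig_mode P l) k = (if k = l then 1 else 0)"
proof -
  \<comment> \<open>The nodes start at -P/2 and not at 0, which contributes a phase independent of
    \<open>p\<close>; it equals 1 in the only case \<open>k = l\<close> in which the sum
    survives.\<close>
  have "trig_mode P (l - k) (node P M (real p)) =
      cis (- (pi * of_int (l - k))) * cis (2 * pi * of_int (l - k) * real p / real M)" for p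
  proof -
    have "2 * pi * of_int (l - k) * node P M (real p) / P =
        - (pi * of_int (l - k)) + 2 * pi * of_int (l - k) * real p / real M"
      using assms(1,2) by (simp add: node_def field_simps)
    then show ?thesis by (simp add: trig_mode_def cis_mult)
  qed
  then have "(\<Sum>p<M. trig_mode P l (node P M (real p)) * trig_mode P (- k) (node P M (real p))) =
      cis (- (pi * of_int (l - k))) * (if int M dvd l - k then of_nat M else 0)"
    using sum_root_of_unity[OF assms(1), of "l - k"]
    by (simp flip: sum_distrib_left trig_mode_freq_diff)
  moreover have "int M dvd l - k \<longleftrightarrow> k = l"
  proof
    assume "int M dvd l - k"
    moreover have "\<bar>l - k\<bar> < int M"
      using assms(3,4) by (auto simp: freqs_def)
    ultimately show "k = l"
      using dvd_imp_le_int[of "l - k" "int M"] by auto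
  qed simp
  ultimately show ?thesis
    using assms(1) by (simp add: dft_coeff_def)
qed

lemma trig_interp_trig_mode:
  assumes "M > 0" "P \<noteq> 0" "l \<in> freqs M"
  shows "trig_interp P M (trig_mode P l) t = trig_mode P l t"
proof -
  have "trig_interp P M (trig_mode P l) t = (\<Sum>k\<in>freqs M. if k = l then trig_mode P k t else 0)"
    unfolding trig_interp_dft by (rule sum.cong) (use assms in \<open>auto simp: dft_coeff_trig_mode\<close>)
  then show ?thesis using assms by (simp add: sum.delta')
qed

lemma norm_trig_interp_le:
  assumes "\<And>t. norm (u t) \<le> B"
  shows "norm (trig_interp P M u t) \<le> real M * B"
proof -
  have "norm (trig_interp P M u t) \<le> (\<Sum>p<M. B)"
    unfolding trig_interp_def
  proof (rule sum_norm_le)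
    fix p
    show "norm (u (node P M (real p)) * cardinal_fun P M p t) \<le> B"
      using mult_mono[OF assms[of "node P M (real p)"] norm_cardinal_fun_le[of P M p t]]
        order_trans[OF norm_ge_zero assms[of 0]]
      by (simp add: norm_mult)
  qed
  then show ?thesis by simp
qed

text \<open>Interpolation on \<open>M\<close> nodes factors through interpolation on the finer grid of \<open>K * M\<close> nodes,
  which is exact at its own nodes; the difference of the two interpolants only involves
  frequencies that the coarse grid does not resolve.\<close>

lemma trig_interp_error_fine_node:
  assumes "M > 0" "K > 0" "P \<noteq> 0" "q < K * M"
  shows "norm (u (node P (K * M) (real q)) - trig_interp P M u (node P (K * M) (real q)))
     \<le> (1 + real M) * (\<Sum>l\<in>freqs (K * M) - freqs M. norm (dft_coeff P (K * M) u l))"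
proof -
  let ?N = "K * M"
  let ?x = "node P ?N (real q)"
  let ?c = "dft_coeff P ?N u"
  have N: "?N > 0" using assms by simp
  \<comment> \<open>Coarse node \<open>p\<close> is fine node \<open>K * p\<close>, where the fine
    expansion of \<open>u\<close> is exact. By linearity, the coarse interpolant of \<open>u\<close>
    is that expansion with every mode replaced by its own coarse interpolant.\<close>
  have coarse: "trig_interp P M u t = (\<Sum>l\<in>freqs ?N. ?c l * trig_interp P M (trig_mode P l) t)" for t
  proof -
    have "u (node P M (real p)) = (\<Sum>l\<in>freqs ?N. ?c l * trig_mode P l (node P M (real p)))" if "p < M" for p
    proof -
      have "node P M (real p) = node P ?N (real (K * p))"
        using assms by (simp add: node_def)
      moreover have "K * p < ?N" using that assms by simp
      ultimately show ?thesis
        using trig_interp_node[OF N assms(3), of "K * p" u] by (simp add: trig_interp_dft)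
    qed
    then have "trig_interp P M u t =
        (\<Sum>p<M. \<Sum>l\<in>freqs ?N. ?c l * (trig_mode P l (node P M (real p)) * cardinal_fun P M p t))"
      unfolding trig_interp_def by (intro sum.cong) (simp_all add: sum_distrib_right mult.assoc)
    also have "\<dots> = (\<Sum>l\<in>freqs ?N. ?c l * trig_interp P M (trig_mode P l) t)"
      unfolding trig_interp_def by (subst sum.swap) (simp add: sum_distrib_left)
    finally show ?thesis .
  qed
  have "u ?x = (\<Sum>l\<in>freqs ?N. ?c l * trig_mode P l ?x)"
    using trig_interp_node[OF N assms(3,4), of u] by (simp add: trig_interp_dft)
  then have "u ?x - trig_interp P M u ?x =
      (\<Sum>l\<in>freqs ?N. ?c l * (trig_mode P l ?x - trig_interp P M (trig_mode P l) ?x))"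
    by (simp add: coarse sum_subtractf right_diff_distrib)
  also have "\<dots> = (\<Sum>l\<in>freqs ?N - freqs M. ?c l * (trig_mode P l ?x - trig_interp P M (trig_mode P l) ?x))"
    by (rule sum.mono_neutral_right) (use assms in \<open>auto simp: trig_interp_trig_mode\<close>)
  finally have eq: "u ?x - trig_interp P M u ?x =
      (\<Sum>l\<in>freqs ?N - freqs M. ?c l * (trig_mode P l ?x - trig_interp P M (trig_mode P l) ?x))" .
  show ?thesis
    unfolding eq sum_distrib_left
  proof (rule sum_norm_le)
    fix l
    \<comment> \<open>An unresolved mode has modulus 1 and its coarse interpolant at most
      \<open>M\<close>; here aliasing is paid for with one power of \<open>M\<close>.\<close>
    have "norm (trig_mode P l ?x - trig_interp P M (trig_mode P l) ?x) \<le> 1 + real M"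
      using norm_triangle_ineq4[of "trig_mode P l ?x" "trig_interp P M (trig_mode P l) ?x"]
        norm_trig_interp_le[of "trig_mode P l" 1 P M ?x] by simp
    then show "norm (?c l * (trig_mode P l ?x - trig_interp P M (trig_mode P l) ?x))
        \<le> (1 + real M) * norm (?c l)"
      by (subst mult.commute) (simp add: norm_mult mult_right_mono)
  qed
qed

section \<open>Spectral accuracy in one variable\<close>

definition fwd_diff :: "real \<Rightarrow> (real \<Rightarrow> real) \<Rightarrow> real \<Rightarrow> real" where
  "fwd_diff h u t = u (t + h) - u t"

text \<open>The induction replaces the whole family \<open>D\<close> by its differences, which again
  form a chain of derivatives. The mean value theorem then trades one derivative for one factor
  \<open>h\<close>.\<close>

lemma fwd_diff_iterate_bound:
  fixes D :: "nat \<Rightarrow> real \<Rightarrow> real"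
  assumes "\<And>n t. (D n has_real_derivative D (Suc n) t) (at t)"
    and "\<And>t. \<bar>D m t\<bar> \<le> B" and "h \<ge> 0"
  shows "\<bar>(fwd_diff h ^^ m) (D 0) t\<bar> \<le> h ^ m * B"
  using assms(1,2)
proof (induction m arbitrary: D B)
  case 0
  then show ?case by simp
next
  case (Suc m)
  define D' where "D' n = fwd_diff h (D n)" for n
  have "(D' n has_real_derivative D' (Suc n) t) (at t)" for n t
    unfolding D'_def fwd_diff_def using Suc.prems(1)
    by (auto intro!: derivative_eq_intros DERIV_shift[THEN iffD1])
  moreover have "\<bar>D' m t\<bar> \<le> h * B" for t
  proof (cases "h = 0")
    case True
    then show ?thesis by (simp add: D'_def fwd_diff_def)
  next
    case False
    then obtain z where "D m (t + h) - D m t = (t + h - t) * D (Suc m) z"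
      using MVT2[of t "t + h" "D m" "D (Suc m)"] Suc.prems(1) assms(3) by auto
    then show ?thesis
      using Suc.prems(2)[of z] assms(3) by (simp add: D'_def fwd_diff_def abs_mult mult_left_mono)
  qed
  ultimately have "\<bar>(fwd_diff h ^^ m) (D' 0) t\<bar> \<le> h ^ m * (h * B)"
    by (rule Suc.IH)
  then show ?case
    by (simp add: D'_def funpow_Suc_right mult_ac del: funpow.simps)
qed

text \<open>Multiplying by \<open>cis (- \<theta>)\<close> shifts the samples by one index, so
  \<open>cis (- \<theta>) - 1\<close> acts as a forward difference; there are no boundary terms
  because the samples vanish outside the range. The range grows by one on the left each time, since
  the difference at \<open>a - 1\<close> still sees the sample at \<open>a\<close>.\<close>

lemma summation_by_parts_iterate:
  fixes u :: "real \<Rightarrow> real" and a b :: int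
  assumes "\<And>p. p \<notin> {a..b} \<Longrightarrow> u (c + h * of_int p) = 0"
  shows "(cis (- \<theta>) - 1) ^ m * (\<Sum>p\<in>{a..b}. of_real (u (c + h * of_int p)) * cis (\<theta> * of_int p))
     = (\<Sum>p\<in>{a - int m..b}. of_real ((fwd_diff h ^^ m) u (c + h * of_int p)) * cis (\<theta> * of_int p))"
  using assms
proof (induction m arbitrary: u a)
  case 0
  then show ?case by simp
next
  case (Suc m)
  let ?x = "\<lambda>p. c + h * of_int p"
  let ?E = "\<lambda>p. cis (\<theta> * of_int p)"
  have step: "?x p + h = ?x (p + 1)" for p
    by (simp add: algebra_simps)
  have van: "fwd_diff h u (?x p) = 0" if "p \<notin> {a - 1..b}" for p
  proof -
    have "p \<notin> {a..b}" "p + 1 \<notin> {a..b}" using that by auto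
    then show ?thesis
      using Suc.prems[of p] Suc.prems[of "p + 1"] by (simp add: fwd_diff_def step del: of_int_add)
  qed
  have shifted: "(\<Sum>p\<in>{a - 1..b}. of_real (u (?x (p + 1))) * ?E p)
      = cis (- \<theta>) * (\<Sum>p\<in>{a..b}. of_real (u (?x p)) * ?E p)"
  proof -
    have "(\<Sum>p\<in>{a - 1..b}. of_real (u (?x (p + 1))) * ?E p)
        = (\<Sum>p\<in>{a..b + 1}. of_real (u (?x p)) * ?E (p - 1))"
      by (rule sum.reindex_bij_witness[where i = "\<lambda>p. p - 1" and j = "\<lambda>p. p + 1"]) auto
    also have "\<dots> = (\<Sum>p\<in>{a..b}. of_real (u (?x p)) * ?E (p - 1))"
      by (rule sum.mono_neutral_right) (use Suc.prems in auto)
    also have "\<dots> = (\<Sum>p\<in>{a..b}. cis (- \<theta>) * (of_real (u (?x p)) * ?E p))"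
    proof (rule sum.cong)
      fix p
      have "?E (p - 1) = cis (- \<theta>) * ?E p"
        by (simp add: cis_mult algebra_simps)
      then show "of_real (u (?x p)) * ?E (p - 1) = cis (- \<theta>) * (of_real (u (?x p)) * ?E p)"
        by simp
    qed simp
    finally show ?thesis by (simp add: sum_distrib_left)
  qed
  have unshifted: "(\<Sum>p\<in>{a - 1..b}. of_real (u (?x p)) * ?E p) = (\<Sum>p\<in>{a..b}. of_real (u (?x p)) * ?E p)"
    by (rule sum.mono_neutral_right) (use Suc.prems in auto)
  have "(\<Sum>p\<in>{a - 1..b}. of_real (fwd_diff h u (?x p)) * ?E p)
      = (\<Sum>p\<in>{a - 1..b}. of_real (u (?x (p + 1))) * ?E p) - (\<Sum>p\<in>{a - 1..b}. of_real (u (?x p)) * ?E p)"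
    by (simp only: fwd_diff_def step of_real_diff left_diff_distrib sum_subtractf)
  also have "\<dots> = (cis (- \<theta>) - 1) * (\<Sum>p\<in>{a..b}. of_real (u (?x p)) * ?E p)"
    unfolding shifted unshifted by (simp add: algebra_simps)
  finally have "(cis (- \<theta>) - 1) ^ Suc m * (\<Sum>p\<in>{a..b}. of_real (u (?x p)) * ?E p)
      = (cis (- \<theta>) - 1) ^ m * (\<Sum>p\<in>{a - 1..b}. of_real (fwd_diff h u (?x p)) * ?E p)"
    by simp
  also have "\<dots> = (\<Sum>p\<in>{a - 1 - int m..b}. of_real ((fwd_diff h ^^ m) (fwd_diff h u) (?x p)) * ?E p)"
    by (rule Suc.IH) (rule van)
  finally show ?case
    by (simp add: funpow_Suc_right algebra_simps del: funpow.simps)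
qed

text \<open>Jordan's inequality: by concavity the sine lies above its chord from 0 to pi/2.\<close>

lemma sin_ge_linear:
  assumes "0 \<le> x" "x \<le> pi / 2"
  shows "2 * x / pi \<le> sin x"
proof -
  have "concave_on {0..pi} sin"
  proof (rule f''_le0_imp_concave)
    show "convex {0..pi}" by simp
    show "(sin has_real_derivative cos x) (at x)" "(cos has_real_derivative - sin x) (at x)" for x :: real
      by (auto intro!: derivative_eq_intros)
    show "- sin x \<le> 0" if "x \<in> {0..pi}" for x :: real
      using that sin_ge_zero by simp
  qed
  moreover have "0 \<le> 2 * x / pi" "2 * x / pi \<le> 1"
    using assms by (auto simp: field_simps)
  ultimately have "(1 - 2 * x / pi) * sin 0 + 2 * x / pi * sin (pi / 2)
      \<le> sin ((1 - 2 * x / pi) *\<^sub>R 0 + (2 * x / pi) *\<^sub>R (pi / 2))"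
    by (intro concave_onD) auto
  then show ?thesis by simp
qed

lemma norm_cis_minus_one_ge:
  assumes "\<bar>t\<bar> \<le> pi"
  shows "2 * \<bar>t\<bar> / pi \<le> norm (cis t - 1)"
proof -
  have "norm (cis t - 1) = 2 * \<bar>sin (t / 2)\<bar>"
    using dist_exp_i_1[of t] by (simp add: cis_conv_exp)
  moreover have "\<bar>sin (t / 2)\<bar> = \<bar>sin (\<bar>t\<bar> / 2)\<bar>"
    by (cases "t \<ge> 0") auto
  moreover have "2 * (\<bar>t\<bar> / 2) / pi \<le> sin (\<bar>t\<bar> / 2)"
    using assms by (intro sin_ge_linear) auto
  ultimately show ?thesis by linarith
qed

text \<open>After \<open>m\<close> summations by parts there are \<open>N + m\<close>, hence at most
  \<open>N * (1 + m)\<close>, terms of size \<open>h ^ m * B\<close>; the first factor cancels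
  against the normalization by \<open>N\<close>. Since |l| \<le> N/2, the angle is at most pi and
  \<open>cis (- \<theta>) - 1\<close> has modulus at least \<open>g = 4 |l| / N\<close>. In
  \<open>h / g\<close> the remaining \<open>N\<close> cancels, so the bound is the same on all
  grids.\<close>

lemma dft_coeff_bound:
  fixes D :: "nat \<Rightarrow> real \<Rightarrow> real"
  assumes D: "\<And>n t. (D n has_real_derivative D (Suc n) t) (at t)"
    and B: "\<And>t. \<bar>D m t\<bar> \<le> B"
    and van: "\<And>t. \<bar>t\<bar> \<ge> P / 2 \<Longrightarrow> D 0 t = 0"
    and "P > 0" "N > 0" "l \<in> freqs N" "l \<noteq> 0"
  shows "norm (dft_coeff P N (\<lambda>t. of_real (D 0 t)) l) \<le> (1 + real m) * (P / (4 * real_of_int \<bar>l\<bar>)) ^ m * B"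
proof -
  define h where "h = P / real N"
  define c where "c = - (P / 2)"
  define \<theta> where "\<theta> = - 2 * pi * of_int l / real N"
  have node: "node P N s = c + h * s" for s
    by (simp add: node_def c_def h_def)
  have h: "h > 0" using assms by (simp add: h_def)
  have B0: "B \<ge> 0" using B[of 0] by linarith
  let ?S = "\<Sum>p\<in>{0..int N - 1}. of_real (D 0 (c + h * of_int p)) * cis (\<theta> * of_int p)"
  have mode: "trig_mode P (- l) (node P N (real p)) = cis (pi * of_int l) * cis (\<theta> * real p)" for p
  proof -
    have "2 * pi * of_int (- l) * node P N (real p) / P = pi * of_int l + \<theta> * real p"
      using assms(4,5) by (simp add: node_def \<theta>_def field_simps)
    then show ?thesis by (simp add: trig_mode_def cis_mult)
  qed
  have "(\<Sum>p<N. of_real (D 0 (node P N (real p))) * trig_mode P (- l) (node P N (real p)))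
      = cis (pi * of_int l) * (\<Sum>p<N. of_real (D 0 (c + h * real p)) * cis (\<theta> * real p))"
    unfolding mode unfolding node by (simp add: sum_distrib_left mult_ac)
  also have "(\<Sum>p<N. of_real (D 0 (c + h * real p)) * cis (\<theta> * real p)) = ?S"
    by (rule sum.reindex_bij_witness[where i = nat and j = int]) auto
  finally have coeff: "norm (dft_coeff P N (\<lambda>t. of_real (D 0 t)) l) = norm ?S / real N"
    by (simp add: dft_coeff_def norm_divide norm_mult)
  \<comment> \<open>Index \<open>N\<close> falls exactly on P/2, which is why vanishing is assumed
    for the closed inequality.\<close>
  have out: "D 0 (c + h * of_int p) = 0" if "p \<notin> {0..int N - 1}" for p
  proof (rule van)
    from that have "p < 0 \<or> p \<ge> int N" by auto
    then consider "p < 0" | "p \<ge> int N" by blast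
    then show "P / 2 \<le> \<bar>c + h * of_int p\<bar>"
    proof cases
      case 1
      then have "h * of_int p \<le> 0" using h by (simp add: mult_nonneg_nonpos)
      then show ?thesis using \<open>P > 0\<close> by (simp add: c_def)
    next
      case 2
      then have "h * of_int p \<ge> h * real N" using h by simp
      then have "h * of_int p \<ge> P" using \<open>N > 0\<close> by (simp add: h_def)
      then show ?thesis using \<open>P > 0\<close> by (simp add: c_def)
    qed
  qed
  have parts: "(cis (- \<theta>) - 1) ^ m * ?S = (\<Sum>p\<in>{0 - int m..int N - 1}.
      of_real ((fwd_diff h ^^ m) (D 0) (c + h * of_int p)) * cis (\<theta> * of_int p))"
    by (rule summation_by_parts_iterate) (rule out)
  have "norm ((cis (- \<theta>) - 1) ^ m * ?S) \<le> (\<Sum>p\<in>{0 - int m..int N - 1}. h ^ m * B)"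
    unfolding parts
  proof (rule sum_norm_le)
    fix p :: int
    show "norm (of_real ((fwd_diff h ^^ m) (D 0) (c + h * of_int p)) * cis (\<theta> * of_int p)) \<le> h ^ m * B"
      using fwd_diff_iterate_bound[OF D B, of h "c + h * of_int p"] h by (simp add: norm_mult)
  qed
  also have "\<dots> = (real N + real m) * (h ^ m * B)"
    using \<open>N > 0\<close> by (simp add: nat_diff_distrib nat_add_distrib)
  also have "\<dots> \<le> (real N * (1 + real m)) * (h ^ m * B)"
  proof (rule mult_right_mono)
    have "1 * real m \<le> real N * real m"
      using \<open>N > 0\<close> by (intro mult_right_mono) auto
    then show "real N + real m \<le> real N * (1 + real m)"
      by (simp add: algebra_simps)
  qed (use h B0 in simp)
  finally have up: "norm (cis (- \<theta>) - 1) ^ m * norm ?S \<le> real N * (1 + real m) * (h ^ m * B)"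
    by (simp add: norm_mult norm_power)
  define g where "g = 4 * real_of_int \<bar>l\<bar> / real N"
  have g: "g > 0" using assms by (simp add: g_def)
  have "g \<le> norm (cis (- \<theta>) - 1)"
  proof -
    have "2 * \<bar>l\<bar> \<le> int N" using \<open>l \<in> freqs N\<close> by (auto simp: freqs_def)
    then have "2 * real_of_int \<bar>l\<bar> \<le> real N" by linarith
    then have "\<bar>- \<theta>\<bar> \<le> pi"
      using \<open>N > 0\<close> by (simp add: \<theta>_def abs_mult field_simps)
    moreover have "2 * \<bar>- \<theta>\<bar> / pi = g"
      by (simp add: \<theta>_def g_def abs_mult)
    ultimately show ?thesis using norm_cis_minus_one_ge[of "- \<theta>"] by simp
  qed
  then have "g ^ m * norm ?S \<le> norm (cis (- \<theta>) - 1) ^ m * norm ?S"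
    using g by (intro mult_right_mono power_mono) auto
  with up have "g ^ m * norm ?S \<le> real N * (1 + real m) * (h ^ m * B)" by linarith
  then have "norm ?S \<le> real N * (1 + real m) * (h ^ m * B) / g ^ m"
    using g by (simp add: pos_le_divide_eq mult.commute)
  then have "norm ?S / real N \<le> (1 + real m) * (h / g) ^ m * B"
    using \<open>N > 0\<close> by (simp add: divide_le_eq power_divide mult_ac)
  also have "h / g = P / (4 * real_of_int \<bar>l\<bar>)"
    using \<open>N > 0\<close> by (simp add: h_def g_def)
  finally show ?thesis by (simp only: coeff)
qed

text \<open>The induction needs the sharper bound 2 - 1/n, because 1/(n+1)^2 is then absorbed by the
  telescoping 1/n - 1/(n+1). The two signs of \<open>l\<close> double the result.\<close>

lemma sum_inverse_squares_int_le:
  assumes "finite A" "0 \<notin> A"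
  shows "(\<Sum>l\<in>A. 1 / (real_of_int l)\<^sup>2) \<le> 4"
proof -
  have nat: "(\<Sum>k\<in>{1..n}. 1 / (real k)\<^sup>2) \<le> 2 - 1 / real n" if "n \<ge> 1" for n :: nat
    using that
  proof (induction n rule: dec_induct)
    case (step n)
    have "1 / (real (Suc n))\<^sup>2 \<le> 1 / (real n * real (Suc n))"
      using step by (intro divide_left_mono) (auto simp: power2_eq_square)
    also have "\<dots> = 1 / real n - 1 / real (Suc n)"
      using step by (simp add: field_simps)
    finally show ?case using step by simp
  qed simp
  define n where "n = nat (Max (insert 1 (abs ` A)))"
  have Max1: "Max (insert 1 (abs ` A)) \<ge> 1"
    using assms by (intro Max_ge) auto
  then have n_eq: "int n = Max (insert 1 (abs ` A))"
    by (simp add: n_def)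
  have n: "\<bar>l\<bar> \<le> int n" if "l \<in> A" for l
    using Max_ge[of "insert 1 (abs ` A)" "\<bar>l\<bar>"] assms that by (simp add: n_eq)
  have n1: "n \<ge> 1"
    using Max1 n_eq by linarith
  have "(\<Sum>l\<in>A. 1 / (real_of_int l)\<^sup>2) \<le> (\<Sum>l\<in>int ` {1..n} \<union> (\<lambda>k. - int k) ` {1..n}. 1 / (real_of_int l)\<^sup>2)"
  proof (rule sum_mono2)
    show "A \<subseteq> int ` {1..n} \<union> (\<lambda>k. - int k) ` {1..n}"
    proof
      fix l assume "l \<in> A"
      then have "\<bar>l\<bar> \<le> int n" "l \<noteq> 0"
        using n assms by auto
      then have "l = int (nat \<bar>l\<bar>) \<or> l = - int (nat \<bar>l\<bar>)" "nat \<bar>l\<bar> \<in> {1..n}"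
        by auto
      then show "l \<in> int ` {1..n} \<union> (\<lambda>k. - int k) ` {1..n}"
        by blast
    qed
  qed auto
  also have "\<dots> = (\<Sum>l\<in>int ` {1..n}. 1 / (real_of_int l)\<^sup>2) + (\<Sum>l\<in>(\<lambda>k. - int k) ` {1..n}. 1 / (real_of_int l)\<^sup>2)"
    by (rule sum.union_disjoint) auto
  also have "\<dots> = 2 * (\<Sum>k\<in>{1..n}. 1 / (real k)\<^sup>2)"
    by (simp add: sum.reindex inj_on_def)
  also have "\<dots> \<le> 4"
    using nat[OF n1] by (smt (verit) divide_nonneg_nonneg of_nat_0_le_iff)
  finally show ?thesis .
qed

text \<open>Of the \<open>m + 2\<close> derivatives, two are spent on the summable weight 1/l^2,
  whose sum contributes the factor 4. The other \<open>m\<close> become powers of 1/M through |l|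
  \<ge> M/2, which accounts for \<open>2 ^ m\<close>.\<close>

lemma dft_coeff_tail_bound:
  fixes D :: "nat \<Rightarrow> real \<Rightarrow> real"
  assumes D: "\<And>n t. (D n has_real_derivative D (Suc n) t) (at t)"
    and B: "\<And>t. \<bar>D (m + 2) t\<bar> \<le> B"
    and van: "\<And>t. \<bar>t\<bar> \<ge> P / 2 \<Longrightarrow> D 0 t = 0"
    and "P > 0" "M > 0" "N > 0"
  shows "(\<Sum>l\<in>freqs N - freqs M. norm (dft_coeff P N (\<lambda>t. of_real (D 0 t)) l))
     \<le> 4 * (3 + real m) * (P / 4) ^ (m + 2) * B * 2 ^ m / real M ^ m"
proof -
  define Q where "Q = (3 + real m) * (P / 4) ^ (m + 2) * B * 2 ^ m / real M ^ m"
  have B0: "B \<ge> 0" using B[of 0] by linarith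
  then have Q0: "Q \<ge> 0" using assms by (simp add: Q_def)
  have zero: "0 \<in> freqs M"
    using \<open>M > 0\<close> by (auto simp: freqs_def)
  have "(\<Sum>l\<in>freqs N - freqs M. norm (dft_coeff P N (\<lambda>t. of_real (D 0 t)) l))
      \<le> (\<Sum>l\<in>freqs N - freqs M. Q * (1 / (real_of_int l)\<^sup>2))"
  proof (rule sum_mono)
    fix l assume l: "l \<in> freqs N - freqs M"
    then have l0: "l \<noteq> 0" using zero by auto
    define a where "a = real_of_int \<bar>l\<bar>"
    have "int M \<le> 2 * \<bar>l\<bar>" using l by (auto simp: freqs_def)
    then have "real M \<le> 2 * a" unfolding a_def by linarith
    then have aM: "real M / 2 \<le> a" by simp
    have a0: "a > 0" using l0 by (simp add: a_def)
    have "norm (dft_coeff P N (\<lambda>t. of_real (D 0 t)) l) \<le> (1 + real (m + 2)) * (P / (4 * a)) ^ (m + 2) * B"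
      unfolding a_def using l l0 assms by (intro dft_coeff_bound) auto
    also have "\<dots> = (3 + real m) * (P / 4) ^ (m + 2) * B * (1 / a ^ m) * (1 / a\<^sup>2)"
      by (simp add: power_divide power_mult_distrib power_add power2_eq_square)
    also have "\<dots> \<le> (3 + real m) * (P / 4) ^ (m + 2) * B * (1 / (real M / 2) ^ m) * (1 / a\<^sup>2)"
      using aM a0 B0 assms
      by (intro mult_right_mono mult_left_mono divide_left_mono power_mono mult_pos_pos) auto
    also have "\<dots> = Q * (1 / (real_of_int l)\<^sup>2)"
      by (simp add: Q_def a_def power_divide)
    finally show "norm (dft_coeff P N (\<lambda>t. of_real (D 0 t)) l) \<le> Q * (1 / (real_of_int l)\<^sup>2)" .
  qed
  also have "\<dots> = Q * (\<Sum>l\<in>freqs N - freqs M. 1 / (real_of_int l)\<^sup>2)"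
    by (rule sum_distrib_left[symmetric])
  also have "\<dots> \<le> Q * 4"
    using zero Q0 by (intro mult_left_mono sum_inverse_squares_int_le) auto
  also have "\<dots> = 4 * (3 + real m) * (P / 4) ^ (m + 2) * B * 2 ^ m / real M ^ m"
    by (simp only: Q_def times_divide_eq_left times_divide_eq_right mult_ac)
  finally show ?thesis .
qed

lemma continuous_on_trig_interp: "continuous_on A (trig_interp P M u)"
  unfolding trig_interp_dft[abs_def] trig_mode_def cis_conv_exp divide_inverse
  by (intro continuous_intros)

text \<open>The estimate holds on all finer grids with a bound independent of the refinement, hence on
  their dense union.\<close>

lemma trig_interp_error:
  fixes D :: "nat \<Rightarrow> real \<Rightarrow> real"
  assumes D: "\<And>n t. (D n has_real_derivative D (Suc n) t) (at t)"
    and B: "\<And>t. \<bar>D (m + 2) t\<bar> \<le> B"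
    and van: "\<And>t. \<bar>t\<bar> \<ge> P / 2 \<Longrightarrow> D 0 t = 0"
    and P: "P > 0" and M: "M > 0" and t: "- (P / 2) \<le> t" "t < P / 2"
  shows "norm (of_real (D 0 t) - trig_interp P M (\<lambda>t. of_real (D 0 t)) t)
     \<le> (1 + real M) * (4 * (3 + real m) * (P / 4) ^ (m + 2) * B * 2 ^ m / real M ^ m)"
    (is "_ \<le> ?E")
proof -
  define err where "err t = norm (of_real (D 0 t) - trig_interp P M (\<lambda>t. of_real (D 0 t)) t)" for t
  define s where "s = (t + P / 2) / P"
  have t_eq: "t = P * s - P / 2" using P by (simp add: s_def field_simps)
  have s: "0 \<le> s" "s < 1" using t P by (auto simp: s_def)
  \<comment> \<open>The fine node immediately to the left of \<open>t\<close>, or \<open>t\<close>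
    itself. The strict bound \<open>s < 1\<close>, that is \<open>t < P / 2\<close>, keeps its index
    below \<open>K * M\<close>.\<close>
  define q where "q K = nat \<lfloor>s * real (K * M)\<rfloor>" for K
  define x where "x n = node P (Suc n * M) (real (q (Suc n)))" for n
  have fl: "real (q K) \<le> s * real (K * M)" "s * real (K * M) - 1 \<le> real (q K)" for K
    using s unfolding q_def by simp_all
  have "err (x n) \<le> ?E" for n
  proof -
    have "real (q (Suc n)) \<le> s * real (Suc n * M)" by (rule fl)
    also have "\<dots> < 1 * real (Suc n * M)" using s M by (intro mult_strict_right_mono) (simp_all del: of_nat_mult)
    finally have "q (Suc n) < Suc n * M" by linarith
    then have "err (x n) \<le> (1 + real M) *
        (\<Sum>l\<in>freqs (Suc n * M) - freqs M. norm (dft_coeff P (Suc n * M) (\<lambda>t. of_real (D 0 t)) l))"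
      unfolding err_def x_def using M P
      by (intro trig_interp_error_fine_node[where u = "\<lambda>t. of_real (D 0 t)"]) auto
    also have "\<dots> \<le> ?E"
      by (intro mult_left_mono dft_coeff_tail_bound[OF D B van P M]) (use M in auto)
    finally show ?thesis .
  qed
  moreover have "(\<lambda>n. err (x n)) \<longlonglongrightarrow> err t"
  proof -
    have "x \<longlonglongrightarrow> t"
    proof (rule LIMSEQ_I)
      fix r :: real assume "r > 0"
      then obtain n0 where n0: "P / r < real n0" using reals_Archimedean2 by blast
      show "\<exists>n0. \<forall>n\<ge>n0. norm (x n - t) < r"
      proof (intro exI allI impI)
        fix n assume "n \<ge> n0"
        define N where "N = real (Suc n * M)"
        have "real (Suc n) * 1 \<le> N" unfolding N_def of_nat_mult using M by (intro mult_left_mono) auto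
        then have N: "N > 0" "N > P / r" using n0 \<open>n \<ge> n0\<close> by auto
        have "x n - t = P * (real (q (Suc n)) - s * N) / N"
          using N(1) unfolding x_def node_def N_def[symmetric] t_eq by (simp add: field_simps)
        moreover have "\<bar>real (q (Suc n)) - s * N\<bar> \<le> 1"
          using fl[of "Suc n"] unfolding N_def by linarith
        ultimately have "\<bar>x n - t\<bar> \<le> P * 1 / N"
          using N(1) P by (simp add: abs_mult divide_right_mono)
        also have "\<dots> < r" using N \<open>r > 0\<close> by (simp add: field_simps)
        finally show "norm (x n - t) < r" by simp
      qed
    qed
    moreover have "isCont err t"
    proof -
      have "isCont (D 0) t" using D DERIV_isCont by blast
      moreover have "isCont (trig_interp P M (\<lambda>t. of_real (D 0 t))) t"
        using continuous_on_trig_interp[of UNIV] by (simp add: continuous_on_eq_continuous_at)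
      ultimately show ?thesis unfolding err_def by (intro continuous_intros)
    qed
    ultimately show ?thesis by (rule isCont_tendsto_compose[rotated])
  qed
  ultimately have "err t \<le> ?E" by (intro LIMSEQ_le_const2) auto
  then show ?thesis by (simp add: err_def)
qed

section \<open>Tensor product interpolation\<close>

definition coord_upd :: "real^'d \<Rightarrow> 'd set \<Rightarrow> ('d \<Rightarrow> real) \<Rightarrow> real^'d" where
  "coord_upd z J x = (\<chi> i. if i \<in> J then x i else z $ i)"

lemma coord_upd_nth [simp]: "coord_upd z J x $ i = (if i \<in> J then x i else z $ i)"
  by (simp add: coord_upd_def)

text \<open>Interpolation in the variables of \<open>J\<close> only, the others being frozen at
  their values in \<open>z\<close>. The subset \<open>J\<close> allows an induction from the
  identity at \<open>{}\<close> to the full interpolant at \<open>UNIV\<close>.\<close>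

definition tensor_interp ::
    "('d \<Rightarrow> real) \<Rightarrow> ('d \<Rightarrow> nat) \<Rightarrow> 'd set \<Rightarrow> (real^'d \<Rightarrow> real) \<Rightarrow> real^'d \<Rightarrow> complex" where
  "tensor_interp P M J f z = (\<Sum>p\<in>PiE J (\<lambda>j. {..<M j}).
     of_real (f (coord_upd z J (\<lambda>j. node (P j) (M j) (real (p j))))) *
     (\<Prod>j\<in>J. cardinal_fun (P j) (M j) (p j) (z $ j)))"

text \<open>Summing over the new index first leaves a one-variable interpolant along the line in
  direction \<open>j\<close> through each partially sampled point. The weights are those of
  \<open>tensor_interp\<close> for \<open>J\<close>, so the difference of the two is a weighted sum
  of one-variable errors.\<close>

lemma tensor_interp_insert:
  fixes z :: "real^'d"
  assumes "j \<notin> J"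
  shows "tensor_interp P M (insert j J) f z = (\<Sum>p\<in>PiE J (\<lambda>j. {..<M j}).
     trig_interp (P j) (M j) (\<lambda>t. of_real (f (coord_upd
       (coord_upd z J (\<lambda>i. node (P i) (M i) (real (p i)))) {j} (\<lambda>_. t)))) (z $ j) *
     (\<Prod>i\<in>J. cardinal_fun (P i) (M i) (p i) (z $ i)))"
proof -
  let ?F = "\<lambda>p. of_real (f (coord_upd z (insert j J) (\<lambda>i. node (P i) (M i) (real (p i))))) *
     (\<Prod>i\<in>insert j J. cardinal_fun (P i) (M i) (p i) (z $ i))"
  have "tensor_interp P M (insert j J) f z
      = (\<Sum>(q, p)\<in>{..<M j} \<times> PiE J (\<lambda>j. {..<M j}). ?F (p(j := q)))"
    unfolding tensor_interp_def PiE_insert_eq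
    by (subst sum.reindex[OF inj_combinator[OF assms]]) (simp add: case_prod_unfold)
  also have "\<dots> = (\<Sum>p\<in>PiE J (\<lambda>j. {..<M j}). \<Sum>q<M j. ?F (p(j := q)))"
    by (subst sum.swap) (simp add: sum.cartesian_product)
  also have "\<dots> = (\<Sum>p\<in>PiE J (\<lambda>j. {..<M j}).
     trig_interp (P j) (M j) (\<lambda>t. of_real (f (coord_upd
       (coord_upd z J (\<lambda>i. node (P i) (M i) (real (p i)))) {j} (\<lambda>_. t)))) (z $ j) *
     (\<Prod>i\<in>J. cardinal_fun (P i) (M i) (p i) (z $ i)))"
    unfolding trig_interp_def sum_distrib_right
  proof (intro sum.cong refl)
    fix p q
    have "coord_upd z (insert j J) (\<lambda>i. node (P i) (M i) (real ((p(j := q)) i))) =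
        coord_upd (coord_upd z J (\<lambda>i. node (P i) (M i) (real (p i)))) {j} (\<lambda>_. node (P j) (M j) (real q))"
      using assms by (auto simp: vec_eq_iff)
    moreover have "(\<Prod>i\<in>insert j J. cardinal_fun (P i) (M i) ((p(j := q)) i) (z $ i)) =
        cardinal_fun (P j) (M j) q (z $ j) * (\<Prod>i\<in>J. cardinal_fun (P i) (M i) (p i) (z $ i))"
      using assms by (subst prod.insert) (auto intro!: prod.cong)
    ultimately show "?F (p(j := q)) =
        of_real (f (coord_upd (coord_upd z J (\<lambda>i. node (P i) (M i) (real (p i)))) {j}
          (\<lambda>_. node (P j) (M j) (real q)))) * cardinal_fun (P j) (M j) q (z $ j) *
        (\<Prod>i\<in>J. cardinal_fun (P i) (M i) (p i) (z $ i))"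
      by (simp only: mult.assoc)
  qed
  finally show ?thesis .
qed

text \<open>Keeps partially sampled points inside the period cell, where the error estimate along
  lines is available.\<close>

lemma node_in_period:
  assumes "P > 0" "p < M"
  shows "node P M (real p) \<in> {- (P / 2)..<P / 2}"
  using assms by (auto simp: node_def field_simps)

text \<open>Replacing one variable after another, each step costs the one-dimensional error times the
  crude Lebesgue constant \<open>W\<close> of the directions already treated; polynomial losses are harmless.\<close>

lemma tensor_interp_error:
  fixes f :: "real^'d \<Rightarrow> real"
  assumes line: "\<And>z j. (\<And>i. z $ i \<in> {- (P i / 2)..<P i / 2}) \<Longrightarrow>
      norm (of_real (f z) - trig_interp (P j) (M j) (\<lambda>t. of_real (f (coord_upd z {j} (\<lambda>_. t)))) (z $ j)) \<le> E"
    and W: "\<And>j. real (M j) \<le> W" "W \<ge> 1"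
    and "E \<ge> 0" "\<And>j. P j > 0"
    and z: "\<And>i. z $ i \<in> {- (P i / 2)..<P i / 2}"
  shows "norm (of_real (f z) - tensor_interp P M J f z) \<le> real (card J) * W ^ card J * E"
proof (induction J rule: finite_induct[OF finite])
  case 1
  have "coord_upd z {} x = z" for x by (simp add: vec_eq_iff)
  then show ?case by (simp add: tensor_interp_def)
next
  case (2 j J)
  let ?Pi = "PiE J (\<lambda>j. {..<M j})"
  let ?y = "\<lambda>p. coord_upd z J (\<lambda>i. node (P i) (M i) (real (p i)))"
  let ?g = "\<lambda>p. \<Prod>i\<in>J. cardinal_fun (P i) (M i) (p i) (z $ i)"
  have "tensor_interp P M J f z - tensor_interp P M (insert j J) f z = (\<Sum>p\<in>?Pi.
      (of_real (f (?y p)) - trig_interp (P j) (M j) (\<lambda>t. of_real (f (coord_upd (?y p) {j} (\<lambda>_. t)))) (z $ j)) * ?g p)"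
    unfolding tensor_interp_insert[OF \<open>j \<notin> J\<close>] tensor_interp_def[of P M J]
    by (simp add: sum_subtractf left_diff_distrib)
  also have "norm \<dots> \<le> (\<Sum>p\<in>?Pi. E)"
  proof (rule sum_norm_le)
    fix p assume p: "p \<in> ?Pi"
    have "norm (of_real (f (?y p)) - trig_interp (P j) (M j)
        (\<lambda>t. of_real (f (coord_upd (?y p) {j} (\<lambda>_. t)))) (?y p $ j)) \<le> E"
    proof (rule line)
      fix i
      show "?y p $ i \<in> {- (P i / 2)..<P i / 2}"
        using p z[of i] node_in_period[OF \<open>P i > 0\<close>, of "p i" "M i"] by (auto simp: PiE_iff)
    qed
    then have "norm (of_real (f (?y p)) - trig_interp (P j) (M j)
        (\<lambda>t. of_real (f (coord_upd (?y p) {j} (\<lambda>_. t)))) (z $ j)) \<le> E"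
      using \<open>j \<notin> J\<close> by simp
    moreover have "norm (?g p) \<le> 1"
      unfolding prod_norm[symmetric] by (intro prod_le_1) (auto simp: norm_cardinal_fun_le)
    ultimately show "norm ((of_real (f (?y p)) - trig_interp (P j) (M j)
        (\<lambda>t. of_real (f (coord_upd (?y p) {j} (\<lambda>_. t)))) (z $ j)) * ?g p) \<le> E"
      using mult_mono[of _ E "norm (?g p)" 1] \<open>E \<ge> 0\<close> by (simp add: norm_mult)
  qed
  also have "\<dots> = (\<Prod>i\<in>J. real (M i)) * E"
    using \<open>finite J\<close> by (simp add: card_PiE)
  also have "\<dots> \<le> (\<Prod>i\<in>J. W) * E"
    by (intro mult_right_mono prod_mono) (use W \<open>E \<ge> 0\<close> in auto)
  finally have "norm (tensor_interp P M J f z - tensor_interp P M (insert j J) f z) \<le> W ^ card J * E"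
    by simp
  with 2 have "norm (of_real (f z) - tensor_interp P M (insert j J) f z)
      \<le> real (card J) * W ^ card J * E + W ^ card J * E"
    using norm_triangle_ineq[of "of_real (f z) - tensor_interp P M J f z"
      "tensor_interp P M J f z - tensor_interp P M (insert j J) f z"] by simp
  also have "\<dots> = (real (card J) + 1) * W ^ card J * E"
    by (simp add: algebra_simps)
  \<comment> \<open>Raising the exponent, possible as \<open>W \<ge> 1\<close>, restores the form of
    the induction claim.\<close>
  also have "\<dots> \<le> (real (card J) + 1) * W ^ Suc (card J) * E"
    using W \<open>E \<ge> 0\<close> by (intro mult_right_mono mult_left_mono power_increasing) auto
  finally show ?case
    using 2 by (simp add: add.commute)
qed

section \<open>The padded Fourier series as a tensor product interpolant\<close>

lemma cis_sum: "cis (\<Sum>i\<in>A. f i) = (\<Prod>i\<in>A. cis (f i))"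
  by (induction A rule: infinite_finite_induct) (auto simp flip: cis_mult)

abbreviation padded_period :: "real \<Rightarrow> real^'d \<Rightarrow> real^'d \<Rightarrow> 'd \<Rightarrow> real" where
  "padded_period L \<gamma> S j \<equiv> 2 * S $ j * L * \<gamma> $ j"

lemma fourier_mode_eq_prod:
  "fourier_mode L \<gamma> S k z = (\<Prod>j\<in>UNIV. trig_mode (padded_period L \<gamma> S j) (k j) (z $ j))"
  by (simp add: fourier_mode_def trig_mode_def cis_sum)

lemma grid_point_nth:
  "grid_point L \<gamma> S n p $ j = node (padded_period L \<gamma> S j) (num_points S n j) (real (p j))"
  by (simp add: grid_point_def node_def)

lemma grid_indices_eq_PiE: "grid_indices S n = PiE UNIV (\<lambda>j. {..<num_points S n j})"
  by (auto simp: grid_indices_def PiE_iff)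

lemma frequencies_eq_PiE: "frequencies S n = PiE UNIV (\<lambda>j. freqs (num_points S n j))"
  by (auto simp: frequencies_def PiE_iff freqs_def)

text \<open>The frequencies form a product set and the modes are products over the directions, so
  after exchanging the sums over grid and frequencies the inner sum factors into one cardinal
  function per direction.\<close>

lemma fourier_series_eq_tensor_interp:
  "fourier_series L \<gamma> S n \<rho> z =
     tensor_interp (padded_period L \<gamma> S) (num_points S n) UNIV (zero_extension L \<gamma> \<rho>) z"
proof -
  let ?P = "padded_period L \<gamma> S"
  let ?M = "num_points S n"
  let ?x = "grid_point L \<gamma> S n"
  let ?r = "\<lambda>p. complex_of_real (zero_extension L \<gamma> \<rho> (?x p))"
  have "fourier_series L \<gamma> S n \<rho> z = (\<Sum>k\<in>frequencies S n. \<Sum>p\<in>grid_indices S n.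
      ?r p * (\<Prod>j\<in>UNIV. trig_mode (?P j) (k j) (z $ j - node (?P j) (?M j) (real (p j))) / of_nat (?M j)))"
    unfolding fourier_series_def fourier_coeff_def sum_divide_distrib sum_distrib_right
    by (intro sum.cong refl)
       (simp add: fourier_mode_eq_prod cnj_trig_mode grid_point_nth trig_mode_diff prod.distrib
         prod_dividef mult_ac)
  also have "\<dots> = (\<Sum>p\<in>grid_indices S n. ?r p * (\<Sum>k\<in>frequencies S n.
      \<Prod>j\<in>UNIV. trig_mode (?P j) (k j) (z $ j - node (?P j) (?M j) (real (p j))) / of_nat (?M j)))"
    by (subst sum.swap) (simp add: sum_distrib_left)
  also have "\<dots> = (\<Sum>p\<in>grid_indices S n. ?r p * (\<Prod>j\<in>UNIV. cardinal_fun (?P j) (?M j) (p j) (z $ j)))"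
    unfolding frequencies_eq_PiE cardinal_fun_def sum_divide_distrib
    by (subst prod_sum_PiE) auto
  also have "\<dots> = tensor_interp ?P ?M UNIV (zero_extension L \<gamma> \<rho>) z"
  proof -
    have "coord_upd z UNIV (\<lambda>j. node (?P j) (?M j) (real (p j))) = ?x p" for p
      by (simp add: vec_eq_iff grid_point_nth)
    then show ?thesis
      by (simp add: tensor_interp_def grid_indices_eq_PiE)
  qed
  finally show ?thesis .
qed

text \<open>The three alternatives are a shift by zero or by one period either way, chosen
  separately in each direction. This serves both the folding into one period cell and the comparison
  of a point with its translate.\<close>

lemma fourier_mode_shift:
  assumes "\<And>j. padded_period L \<gamma> S j \<noteq> 0"
    and "\<And>j. z' $ j = z $ j \<or> z' $ j = z $ j + padded_period L \<gamma> S j \<or> z $ j = z' $ j + padded_period L \<gamma> S j"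
  shows "fourier_mode L \<gamma> S k z' = fourier_mode L \<gamma> S k z"
  unfolding fourier_mode_eq_prod
proof (rule prod.cong[OF refl])
  fix j
  show "trig_mode (padded_period L \<gamma> S j) (k j) (z' $ j) = trig_mode (padded_period L \<gamma> S j) (k j) (z $ j)"
    using assms(2)[of j] trig_mode_period[OF assms(1)[of j]] by metis
qed

lemma fourier_series_shift:
  assumes "\<And>j. padded_period L \<gamma> S j \<noteq> 0"
    and "\<And>j. z' $ j = z $ j \<or> z' $ j = z $ j + padded_period L \<gamma> S j \<or> z $ j = z' $ j + padded_period L \<gamma> S j"
  shows "fourier_series L \<gamma> S n \<rho> z' = fourier_series L \<gamma> S n \<rho> z"
  unfolding fourier_series_def using fourier_mode_shift[OF assms] by simp

section \<open>Smooth densities\<close>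

text \<open>Wanted for the product rule, where undifferentiated factors stand beside
  derivatives.\<close>

lemma Ck_Suc_imp_Ck: "Ck (Suc k) f \<Longrightarrow> Ck k f"
proof (induction k arbitrary: f)
  case 0
  then show ?case
    by (simp add: continuous_on_eq_continuous_at differentiable_imp_continuous_within)
next
  case (Suc k)
  from Suc.prems have "\<forall>x. f differentiable (at x)" "\<forall>v. Ck (Suc k) (\<lambda>x. frechet_derivative f (at x) v)"
    by simp_all
  then show ?case using Suc.IH by simp
qed

lemma Ck_const: "Ck k (\<lambda>x. c)"
  by (induction k arbitrary: c) auto

lemma Ck_add: "Ck k f \<Longrightarrow> Ck k g \<Longrightarrow> Ck k (\<lambda>x. f x + g x)"
proof (induction k arbitrary: f g)
  case 0
  then show ?case by (auto intro: continuous_intros)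
next
  case (Suc k)
  then have "frechet_derivative (\<lambda>x. f x + g x) (at x) =
      (\<lambda>v. frechet_derivative f (at x) v + frechet_derivative g (at x) v)" for x
    by (intro frechet_derivative_at[symmetric] has_derivative_add)
       (auto simp: frechet_derivative_works)
  with Suc show ?case by auto
qed

lemma Ck_mult:
  fixes f g :: "'a::real_normed_vector \<Rightarrow> real"
  shows "Ck k f \<Longrightarrow> Ck k g \<Longrightarrow> Ck k (\<lambda>x. f x * g x)"
proof (induction k arbitrary: f g)
  case 0
  then show ?case by (auto intro: continuous_intros)
next
  case (Suc k)
  then have "frechet_derivative (\<lambda>x. f x * g x) (at x) =
      (\<lambda>v. f x * frechet_derivative g (at x) v + frechet_derivative f (at x) v * g x)" for x
    by (intro frechet_derivative_at[symmetric] has_derivative_mult)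
       (auto simp: frechet_derivative_works)
  moreover have "Ck k (\<lambda>x. f x * frechet_derivative g (at x) v + frechet_derivative f (at x) v * g x)" for v
    using Suc.prems by (intro Ck_add Suc.IH Ck_Suc_imp_Ck[OF Suc.prems(1)] Ck_Suc_imp_Ck[OF Suc.prems(2)]) auto
  ultimately show ?case using Suc.prems by auto
qed

lemma Ck_prod:
  fixes f :: "'i \<Rightarrow> 'a::real_normed_vector \<Rightarrow> real"
  assumes "\<And>i. i \<in> A \<Longrightarrow> Ck k (f i)"
  shows "Ck k (\<lambda>x. \<Prod>i\<in>A. f i x)"
  using assms by (induction A rule: infinite_finite_induct) (auto intro: Ck_const Ck_mult)

lemma smooth_imp_differentiable: "smooth f \<Longrightarrow> f differentiable (at x)"
  unfolding smooth_def using Ck.simps(2) by blast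

lemma smooth_imp_continuous_on: "smooth f \<Longrightarrow> continuous_on UNIV f"
  unfolding smooth_def using Ck.simps(1) by blast

text \<open>The family \<open>t\<^sup>-\<^sup>j exp (-1/t)\<close> is closed under differentiation up to linear combinations,
  which yields all derivatives of \<open>exp (-1/t)\<close> without an explicit formula for them.\<close>

definition flat_exp :: "nat \<Rightarrow> real \<Rightarrow> real" where
  "flat_exp j t = (if t > 0 then inverse t ^ j * exp (- inverse t) else 0)"

text \<open>Under the substitution of 1/t for t this is the decay of a power divided by the
  exponential at infinity.\<close>

lemma flat_exp_tendsto_0: "((\<lambda>t. flat_exp j t) \<longlongrightarrow> 0) (at 0)"
proof -
  have "((\<lambda>t. inverse t ^ j / exp (inverse t)) \<longlongrightarrow> (0::real)) (at_right 0)"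
    by (rule filterlim_compose[OF tendsto_power_div_exp_0 filterlim_inverse_at_top_right])
  then have "((\<lambda>t. flat_exp j t) \<longlongrightarrow> 0) (at_right 0)"
    by (rule Lim_transform_eventually)
       (auto simp: eventually_at_filter flat_exp_def exp_minus divide_inverse)
  moreover have "((\<lambda>t. flat_exp j t) \<longlongrightarrow> 0) (at_left 0)"
    by (rule tendsto_eventually) (auto simp: eventually_at_filter flat_exp_def)
  ultimately show ?thesis using filterlim_split_at by blast
qed

lemma DERIV_flat_exp:
  "(flat_exp j has_real_derivative flat_exp (j + 2) t - real j * flat_exp (j + 1) t) (at t)"
proof (rule linorder_cases[of t 0])
  assume "t < 0"
  have "((\<lambda>_. 0) has_real_derivative 0) (at t)" by simp
  then show ?thesis
    using \<open>t < 0\<close> has_field_derivative_transform_within_open[of "\<lambda>_. 0" 0 t "{..<0}" "flat_exp j"]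
    by (simp add: flat_exp_def)
next
  assume "t = 0"
  \<comment> \<open>The difference quotient at 0 is \<open>flat_exp (Suc j)\<close> itself, whose
    limit is known.\<close>
  have "((\<lambda>h. flat_exp j h / h) \<longlongrightarrow> 0) (at 0)"
    by (rule Lim_transform_eventually[OF flat_exp_tendsto_0[of "Suc j"]])
       (auto simp: eventually_at_filter flat_exp_def divide_inverse)
  then show ?thesis
    using \<open>t = 0\<close> by (simp add: DERIV_def flat_exp_def[of _ 0])
next
  assume "t > 0"
  have "((\<lambda>t. inverse t ^ j * exp (- inverse t)) has_real_derivative
      real j * inverse t ^ (j - 1) * - (inverse t)\<^sup>2 * exp (- inverse t)
      + inverse t ^ j * (exp (- inverse t) * (inverse t)\<^sup>2)) (at t)"
    using \<open>t > 0\<close>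
    by (auto intro!: derivative_eq_intros simp: power2_eq_square)
  moreover have "real j * inverse t ^ (j - 1) * - (inverse t)\<^sup>2 * exp (- inverse t)
      + inverse t ^ j * (exp (- inverse t) * (inverse t)\<^sup>2) = flat_exp (j + 2) t - real j * flat_exp (j + 1) t"
    using \<open>t > 0\<close> by (cases j) (auto simp: flat_exp_def power2_eq_square algebra_simps)
  ultimately show ?thesis
    using \<open>t > 0\<close> has_field_derivative_transform_within_open[of
      "\<lambda>t. inverse t ^ j * exp (- inverse t)" _ t "{0<..}" "flat_exp j"]
    by (simp add: flat_exp_def)
qed

text \<open>Generalizing over \<open>j\<close> closes the induction: a derivative combines two
  members of the same family, with the constant factor \<open>\<alpha> * v $ i\<close> from the
  inner map.\<close>

lemma Ck_flat_exp_affine: "Ck k (\<lambda>x::real^'d. flat_exp j (\<beta> + \<alpha> * x $ i))"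
proof (induction k arbitrary: j)
  case 0
  have "isCont (flat_exp j) t" for t
    using DERIV_flat_exp DERIV_isCont by blast
  then have "continuous_on UNIV (flat_exp j)"
    by (simp add: continuous_on_eq_continuous_at)
  then show ?case
    unfolding Ck.simps by (rule continuous_on_compose2) (auto intro!: continuous_intros)
next
  case (Suc k)
  let ?l = "\<lambda>x::real^'d. \<beta> + \<alpha> * x $ i"
  have der: "((\<lambda>x. flat_exp j (?l x)) has_derivative
      (\<lambda>v. (flat_exp (j + 2) (?l x) + - real j * flat_exp (j + 1) (?l x)) * (\<alpha> * v $ i))) (at x)" for x
  proof -
    have "(?l has_derivative (\<lambda>v. \<alpha> * v $ i)) (at x)"
      by (auto intro!: derivative_eq_intros bounded_linear.has_derivative[OF bounded_linear_vec_nth])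
    from has_derivative_compose[OF this DERIV_flat_exp[of j "?l x", unfolded has_field_derivative_def]]
    show ?thesis by simp
  qed
  have "frechet_derivative (\<lambda>x. flat_exp j (?l x)) (at x) =
     (\<lambda>v. (flat_exp (j + 2) (?l x) + - real j * flat_exp (j + 1) (?l x)) * (\<alpha> * v $ i))" for x
    by (rule frechet_derivative_at[OF der, symmetric])
  moreover have "Ck k (\<lambda>x. (flat_exp (j + 2) (?l x) + - real j * flat_exp (j + 1) (?l x)) * (\<alpha> * v $ i))" for v
    by (intro Ck_mult Ck_add Ck_const Suc)
  ultimately show ?case
    using der by (auto simp: differentiable_def)
qed

lemma density_box_eq_cbox: "density_box L \<gamma> = cbox (- (L *\<^sub>R \<gamma>)) (L *\<^sub>R \<gamma>)"
  by (auto simp: density_box_def mem_box_cart abs_le_iff) (smt (verit))+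

lemma compact_density_box: "compact (density_box L \<gamma>)"
  by (simp add: density_box_eq_cbox)

lemma closed_density_box: "closed (density_box L \<gamma>)"
  by (simp add: density_box_eq_cbox closed_cbox)

text \<open>In each direction the two factors vanish beyond one face each, so their product is a
  smooth bump supported between the faces. Positivity on the whole open box lets one density detect
  failure at any interior point.\<close>

lemma exists_density_positive_inside:
  fixes \<gamma> :: "real^'d"
  shows "\<exists>\<rho>\<in>densities L \<gamma>. \<forall>x. (\<forall>j. \<bar>x $ j\<bar> < L * \<gamma> $ j) \<longrightarrow> \<rho> x > 0"
proof
  define \<rho> where "\<rho> x = (\<Prod>j\<in>UNIV. flat_exp 0 (L * \<gamma> $ j + 1 * x $ j) * flat_exp 0 (L * \<gamma> $ j + (-1) * x $ j))"
    for x :: "real^'d"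
  have "smooth \<rho>"
    unfolding smooth_def \<rho>_def by (intro allI Ck_prod Ck_mult Ck_flat_exp_affine)
  moreover have "{x. \<rho> x \<noteq> 0} \<subseteq> density_box L \<gamma>"
    by (auto simp: \<rho>_def density_box_def flat_exp_def split: if_splits) (smt (verit))
  then have "closure {x. \<rho> x \<noteq> 0} \<subseteq> density_box L \<gamma>"
    by (rule closure_minimal) (rule closed_density_box)
  moreover from this have "compact (closure {x. \<rho> x \<noteq> 0})"
    using bounded_subset[OF compact_imp_bounded[OF compact_density_box]] by (simp add: compact_eq_bounded_closed)
  ultimately show "\<rho> \<in> densities L \<gamma>"
    by (simp add: densities_def)
  show "\<forall>x. (\<forall>j. \<bar>x $ j\<bar> < L * \<gamma> $ j) \<longrightarrow> \<rho> x > 0"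
    by (auto simp: \<rho>_def flat_exp_def abs_less_iff intro!: prod_pos) (smt (verit))+
qed

section \<open>Iterated partial derivatives along a coordinate axis\<close>

definition pderiv_axis :: "'d \<Rightarrow> (real^'d \<Rightarrow> real) \<Rightarrow> real^'d \<Rightarrow> real" where
  "pderiv_axis j f x = frechet_derivative f (at x) (axis j 1)"

lemma smooth_pderiv_axis: "smooth f \<Longrightarrow> smooth (pderiv_axis j f)"
  unfolding smooth_def pderiv_axis_def[abs_def]
proof
  fix k assume "\<forall>k. Ck k f"
  then have "Ck (Suc k) f" by blast
  then show "Ck k (\<lambda>x. frechet_derivative f (at x) (axis j 1))" by simp
qed

lemma smooth_pderiv_axis_iterate: "smooth f \<Longrightarrow> smooth ((pderiv_axis j ^^ n) f)"
  by (induction n) (auto intro: smooth_pderiv_axis)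

lemma pderiv_axis_vanishes:
  assumes "closed K" "\<And>x. x \<notin> K \<Longrightarrow> f x = 0" "x \<notin> K"
  shows "pderiv_axis j f x = 0"
proof -
  have "((\<lambda>_. 0) has_derivative (\<lambda>_. 0)) (at x)" by simp
  then have "(f has_derivative (\<lambda>_. 0)) (at x)"
    by (rule has_derivative_transform_within_open[where s = "- K"]) (use assms in auto)
  then show ?thesis
    unfolding pderiv_axis_def by (simp flip: frechet_derivative_at)
qed

lemma pderiv_axis_iterate_vanishes:
  assumes "closed K" "\<And>x. x \<notin> K \<Longrightarrow> f x = 0" "x \<notin> K"
  shows "(pderiv_axis j ^^ n) f x = 0"
  using assms(3)
proof (induction n arbitrary: x)
  case (Suc n)
  then show ?case using pderiv_axis_vanishes[OF assms(1)] by simp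
qed (use assms in simp)

lemma pderiv_axis_iterate_bounded:
  assumes "smooth f" "compact K" "\<And>x. x \<notin> K \<Longrightarrow> f x = 0"
  shows "\<exists>B. \<forall>x. \<bar>(pderiv_axis j ^^ n) f x\<bar> \<le> B"
proof -
  let ?g = "(pderiv_axis j ^^ n) f"
  have "continuous_on K ?g"
    using smooth_imp_continuous_on[OF smooth_pderiv_axis_iterate[OF assms(1)]] continuous_on_subset by blast
  then have "bounded (?g ` K)"
    using assms(2) compact_continuous_image compact_imp_bounded by blast
  then obtain B where "\<forall>x\<in>K. \<bar>?g x\<bar> \<le> B"
    by (auto simp: bounded_iff)
  moreover have "?g x = 0" if "x \<notin> K" for x
    using pderiv_axis_iterate_vanishes[OF compact_imp_closed[OF assms(2)] assms(3) that] by simp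
  \<comment> \<open>Off \<open>K\<close> the value is 0, and \<open>B\<close> could be negative if
    \<open>K\<close> is empty.\<close>
  ultimately have "\<bar>?g x\<bar> \<le> max B 0" for x
    by (cases "x \<in> K") fastforce+
  then show ?thesis by blast
qed

text \<open>Applied to the iterated partial derivatives, this produces the chain \<open>D\<close> of
  one-variable derivatives that the interpolation estimate expects.\<close>

lemma DERIV_along_axis:
  assumes "\<And>x. f differentiable (at x)"
  shows "((\<lambda>t. f (coord_upd z {j} (\<lambda>_. t))) has_real_derivative
    pderiv_axis j f (coord_upd z {j} (\<lambda>_. t))) (at t)"
proof -
  define z0 where "z0 = coord_upd z {j} (\<lambda>_. 0)"
  have eq: "coord_upd z {j} (\<lambda>_. t) = z0 + t *\<^sub>R axis j 1" for t
    by (auto simp: z0_def vec_eq_iff axis_def)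
  let ?x = "coord_upd z {j} (\<lambda>_. t)"
  have f': "(f has_derivative frechet_derivative f (at ?x)) (at ?x)"
    using assms frechet_derivative_works by blast
  have "((\<lambda>t. coord_upd z {j} (\<lambda>_. t)) has_derivative (\<lambda>h. h *\<^sub>R axis j 1)) (at t)"
    unfolding eq by (auto intro!: derivative_eq_intros)
  from has_derivative_compose[OF this f']
  have "((\<lambda>t. f (coord_upd z {j} (\<lambda>_. t))) has_derivative
      (\<lambda>h. frechet_derivative f (at ?x) (h *\<^sub>R axis j 1))) (at t)" .
  moreover have "(\<lambda>h. frechet_derivative f (at ?x) (h *\<^sub>R axis j 1)) = (*) (pderiv_axis j f ?x)"
    using linear_frechet_derivative[OF assms, of ?x]
    by (auto simp: pderiv_axis_def linear_cmul mult.commute)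
  ultimately show ?thesis by (simp add: has_field_derivative_def)
qed

lemma density_zero_outside:
  assumes "\<rho> \<in> densities L \<gamma>" "x \<notin> density_box L \<gamma>"
  shows "\<rho> x = 0"
  using assms closure_subset[of "{x. \<rho> x \<noteq> 0}"] by (auto simp: densities_def)

text \<open>The set where a continuous function is nonzero is open, so inside the closed box it must
  lie in the interior. Hence the density vanishes on the faces too, which makes the non-strict
  padding condition sufficient.\<close>

lemma density_zero_off_interior:
  assumes "\<rho> \<in> densities L \<gamma>" "\<bar>x $ j\<bar> \<ge> L * \<gamma> $ j"
  shows "\<rho> x = 0"
proof (rule ccontr)
  assume nz: "\<rho> x \<noteq> 0"
  have "open {x. \<rho> x \<noteq> 0}"
    using assms smooth_imp_continuous_on
    by (intro open_Collect_neq) (auto simp: densities_def)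
  then have "{x. \<rho> x \<noteq> 0} \<subseteq> interior (density_box L \<gamma>)"
    using density_zero_outside[OF assms(1)] by (intro interior_maximal) auto
  then have "x \<in> box (- (L *\<^sub>R \<gamma>)) (L *\<^sub>R \<gamma>)"
    using nz by (auto simp: density_box_eq_cbox interior_cbox)
  then have "- (L * \<gamma> $ j) < x $ j" "x $ j < L * \<gamma> $ j"
    by (auto simp: mem_box_cart)
  then show False using assms(2) by linarith
qed

lemma zero_extension_density:
  assumes "\<rho> \<in> densities L \<gamma>"
  shows "zero_extension L \<gamma> \<rho> = \<rho>"
  using density_zero_outside[OF assms] by (auto simp: zero_extension_def)

section \<open>Spectral accuracy and padding\<close>

text \<open>Bounding each factor by the sum of all factors gives a constant independent of the
  direction; the additional 1 absorbs the rounding, since \<open>n \<ge> 1\<close>.\<close>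

lemma num_points_bounds:
  fixes S :: "real^'d"
  assumes "\<And>j. S $ j \<ge> 1" "n \<ge> 1"
  shows "n \<le> num_points S n j" "real (num_points S n j) \<le> ((\<Sum>j\<in>UNIV. S $ j) + 1) * real n"
proof -
  have "1 * real n \<le> S $ j * real n"
    using assms by (intro mult_right_mono) auto
  then have le: "real n \<le> S $ j * real n" by simp
  then show "n \<le> num_points S n j"
    unfolding num_points_def by linarith
  have "real (num_points S n j) \<le> S $ j * real n + 1"
    using le unfolding num_points_def by linarith
  also have "\<dots> \<le> (S $ j + 1) * real n"
    using assms(2) by (simp add: algebra_simps)
  also have "S $ j \<le> (\<Sum>j\<in>UNIV. S $ j)"
    using assms(1) by (intro member_le_sum) (auto intro: order_trans[OF zero_le_one])
  finally show "real (num_points S n j) \<le> ((\<Sum>j\<in>UNIV. S $ j) + 1) * real n"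
    by (simp add: mult_right_mono)
qed

lemma fourier_series_error_padded_box:
  fixes \<gamma> S :: "real^'d"
  assumes "L > 0" "\<And>j. \<gamma> $ j > 0" "\<And>j. S $ j \<ge> 1" and \<rho>: "\<rho> \<in> densities L \<gamma>"
  shows "\<exists>C. \<forall>n\<ge>1. \<forall>z. (\<forall>j. z $ j \<in> {- (padded_period L \<gamma> S j / 2)..<padded_period L \<gamma> S j / 2}) \<longrightarrow>
     norm (fourier_series L \<gamma> S n \<rho> z - of_real (\<rho> z)) \<le> C / real n ^ m"
proof -
  let ?P = "padded_period L \<gamma> S"
  define d where "d = CARD('d)"
  \<comment> \<open>One power is lost to the factor \<open>1 + real (?M j)\<close> of the
    one-variable error, and \<open>d\<close> powers to \<open>(\<sigma> * real n) ^ d\<close> in the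
    tensor product; order \<open>m\<close> remains.\<close>
  define m' where "m' = m + d + 1"
  have smooth: "smooth \<rho>" using \<rho> by (simp add: densities_def)
  have S0: "S $ j > 0" for j
    using assms(3)[of j] by simp
  have P: "?P j > 0" for j
    using assms S0 by simp
  have half: "L * \<gamma> $ j \<le> ?P j / 2" for j
    using mult_right_mono[OF assms(3)[of j], of "L * \<gamma> $ j"] assms(1) less_imp_le[OF assms(2)[of j]] by simp
  have "\<forall>j. \<exists>B. \<forall>x. \<bar>(pderiv_axis j ^^ (m' + 2)) \<rho> x\<bar> \<le> B"
    using pderiv_axis_iterate_bounded[OF smooth compact_density_box density_zero_outside[OF \<rho>]] by blast
  then obtain B where B: "\<bar>(pderiv_axis j ^^ (m' + 2)) \<rho> x\<bar> \<le> B j" for j x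
    by metis
  define a where "a j = 4 * (3 + real m') * (?P j / 4) ^ (m' + 2) * B j * 2 ^ m'" for j
  define A where "A = (\<Sum>j\<in>UNIV. a j)"
  have "B j \<ge> 0" for j using B[of j 0] by linarith
  then have a0: "a j \<ge> 0" for j using less_imp_le[OF P] by (simp add: a_def del: zero_le_mult_iff)
  have aA: "a j \<le> A" for j
    unfolding A_def using a0 by (intro member_le_sum) auto
  have A0: "A \<ge> 0" unfolding A_def using a0 by (simp add: sum_nonneg)
  define \<sigma> where "\<sigma> = (\<Sum>j\<in>UNIV. S $ j) + 1"
  have \<sigma>1: "\<sigma> \<ge> 1"
    unfolding \<sigma>_def using less_imp_le[OF S0] by (simp add: sum_nonneg)
  show ?thesis
  proof (intro exI allI impI)
    fix n :: nat and z :: "real^'d"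
    assume n: "1 \<le> n" and z: "\<forall>j. z $ j \<in> {- (?P j / 2)..<?P j / 2}"
    let ?M = "num_points S n"
    define E where "E = 2 * A / real n ^ (m + d)"
    have M: "n \<le> ?M j" "real (?M j) \<le> \<sigma> * real n" for j
      using num_points_bounds[OF assms(3) n] by (auto simp: \<sigma>_def)
    have "norm (of_real (\<rho> z) - tensor_interp ?P ?M UNIV \<rho> z)
        \<le> real (card (UNIV :: 'd set)) * (\<sigma> * real n) ^ card (UNIV :: 'd set) * E"
    proof (rule tensor_interp_error)
      fix z :: "real^'d" and j
      assume z: "\<And>i. z $ i \<in> {- (?P i / 2)..<?P i / 2}"
      define D where "D k t = (pderiv_axis j ^^ k) \<rho> (coord_upd z {j} (\<lambda>_. t))" for k t
      have self: "coord_upd z {j} (\<lambda>_. z $ j) = z" by (simp add: vec_eq_iff)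
      have Mj: "real (?M j) \<ge> real n" "real (?M j) > 0" using M(1)[of j] n by auto
      have "norm (of_real (D 0 (z $ j)) - trig_interp (?P j) (?M j) (\<lambda>t. of_real (D 0 t)) (z $ j))
          \<le> (1 + real (?M j)) * (4 * (3 + real m') * (?P j / 4) ^ (m' + 2) * B j * 2 ^ m' / real (?M j) ^ m')"
      proof (rule trig_interp_error)
        show "(D k has_real_derivative D (Suc k) t) (at t)" for k t
          unfolding D_def
          using DERIV_along_axis[OF smooth_imp_differentiable[OF smooth_pderiv_axis_iterate[OF smooth]]]
          by simp
        show "\<bar>D (m' + 2) t\<bar> \<le> B j" for t
          unfolding D_def by (rule B)
        show "D 0 t = 0" if "?P j / 2 \<le> \<bar>t\<bar>" for t
          unfolding D_def using that half[of j]
          by (simp add: density_zero_off_interior[OF \<rho>, where j = j])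
        show "?P j > 0" by (rule P)
        show "?M j > 0" using Mj by simp
        show "- (?P j / 2) \<le> z $ j" "z $ j < ?P j / 2" using z[of j] by auto
      qed
      also have "\<dots> = (1 + real (?M j)) * (a j / real (?M j) ^ m')"
        by (simp add: a_def)
      also have "\<dots> \<le> (2 * real (?M j)) * (A / real (?M j) ^ m')"
        using Mj n aA A0 a0 by (intro mult_mono divide_right_mono) auto
      also have "\<dots> = 2 * A / real (?M j) ^ (m + d)"
        using Mj by (simp add: m'_def)
      also have "\<dots> \<le> E"
        unfolding E_def using Mj n A0 by (intro divide_left_mono power_mono mult_pos_pos) auto
      finally show "norm (of_real (\<rho> z) - trig_interp (?P j) (?M j)
          (\<lambda>t. of_real (\<rho> (coord_upd z {j} (\<lambda>_. t)))) (z $ j)) \<le> E"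
        by (simp add: D_def self)
    next
      show "real (?M j) \<le> \<sigma> * real n" for j by (rule M)
      show "1 \<le> \<sigma> * real n" using \<sigma>1 n mult_mono[of 1 \<sigma> 1 "real n"] by simp
      show "E \<ge> 0" using A0 by (simp add: E_def)
      show "?P j > 0" for j by (rule P)
      show "z $ i \<in> {- (?P i / 2)..<?P i / 2}" for i using z by blast
    qed
    also have "\<dots> = real d * \<sigma> ^ d * (2 * A) / real n ^ m"
      using n by (simp add: E_def d_def power_mult_distrib power_add)
    finally show "norm (fourier_series L \<gamma> S n \<rho> z - of_real (\<rho> z)) \<le> real d * \<sigma> ^ d * (2 * A) / real n ^ m"
      by (simp add: fourier_series_eq_tensor_interp zero_extension_density[OF \<rho>] norm_minus_commute)
  qed
qed

lemma spectrally_accurate_if_padded: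
  fixes \<gamma> S :: "real^'d"
  assumes "L > 0" "\<And>j. \<gamma> $ j > 0" "\<And>j. S $ j \<ge> 1" and \<rho>: "\<rho> \<in> densities L \<gamma>"
    and cond: "\<And>j. trunc_radius L \<gamma> j1 + L * \<gamma> $ j \<le> (2 * S $ j - 1) * L * \<gamma> $ j"
  shows "spectrally_accurate_on (extended_box L \<gamma> j1) (\<lambda>n. fourier_series L \<gamma> S n \<rho>) \<rho>"
  unfolding spectrally_accurate_on_def
proof
  fix m
  let ?P = "padded_period L \<gamma> S"
  obtain C where C: "\<And>n z. n \<ge> 1 \<Longrightarrow> (\<And>j. z $ j \<in> {- (?P j / 2)..<?P j / 2}) \<Longrightarrow>
      norm (fourier_series L \<gamma> S n \<rho> z - of_real (\<rho> z)) \<le> C / real n ^ m"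
    using fourier_series_error_padded_box[OF assms(1-4), of m] by blast
  have S0: "S $ j > 0" for j
    using assms(3)[of j] by simp
  have P: "?P j > 0" for j
    using assms S0 by simp
  have half: "L * \<gamma> $ j \<le> ?P j / 2" for j
    using mult_right_mono[OF assms(3)[of j], of "L * \<gamma> $ j"] assms(1) less_imp_le[OF assms(2)[of j]] by simp
  show "\<exists>C. \<forall>n\<ge>1. \<forall>z\<in>extended_box L \<gamma> j1.
      norm (fourier_series L \<gamma> S n \<rho> z - of_real (\<rho> z)) \<le> C / real n ^ m"
  proof (intro exI allI impI ballI)
    fix n :: nat and z :: "real^'d"
    assume n: "1 \<le> n" and z: "z \<in> extended_box L \<gamma> j1"
    \<comment> \<open>Moving by at most one period per direction reaches the half-open cell, since
      the padding condition bounds |z_j| by the period minus L \<gamma>_j.\<close>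
    define z' where "z' = (\<chi> j. if z $ j < - (?P j / 2) then z $ j + ?P j
        else if z $ j \<ge> ?P j / 2 then z $ j - ?P j else z $ j)"
    have zb: "\<bar>z $ j\<bar> \<le> ?P j - L * \<gamma> $ j" for j
    proof -
      have "\<bar>z $ j\<bar> \<le> trunc_radius L \<gamma> j1 + L * \<gamma> $ j"
        using z by (simp add: extended_box_def)
      also have "\<dots> \<le> (2 * S $ j - 1) * L * \<gamma> $ j" by (rule cond)
      finally show ?thesis by (simp add: algebra_simps)
    qed
    have box: "z' $ j \<in> {- (?P j / 2)..<?P j / 2}" for j
    proof -
      have "(if t < - (p / 2) then t + p else if t \<ge> p / 2 then t - p else t) \<in> {- (p / 2)..<p / 2}"
        if "\<bar>t\<bar> \<le> p - l" "l > 0" "p > 0" for t p l :: real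
        using that by auto
      from this[OF zb[of j] mult_pos_pos[OF assms(1) assms(2)[of j]] P[of j]]
      show ?thesis by (simp only: z'_def vec_lambda_beta)
    qed
    have "fourier_series L \<gamma> S n \<rho> z' = fourier_series L \<gamma> S n \<rho> z"
      by (rule fourier_series_shift, rule less_imp_neq[OF P, symmetric]) (auto simp: z'_def)
    moreover have "\<rho> z' = \<rho> z"
    proof (cases "z' = z")
      case False
      then obtain j where j: "z' $ j \<noteq> z $ j" by (auto simp: vec_eq_iff)
      \<comment> \<open>A moved coordinate has modulus at least P_j/2 before the move and P_j -
        |z_j| after it. Both are at least L \<gamma>_j, so one such coordinate makes the density
        vanish at both points.\<close>
      have "\<bar>z $ j\<bar> \<ge> L * \<gamma> $ j" "\<bar>z' $ j\<bar> \<ge> L * \<gamma> $ j"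
        using j zb[of j] half[of j] unfolding z'_def by (auto split: if_splits)
      then show ?thesis
        using density_zero_off_interior[OF \<rho>] by simp
    qed simp
    ultimately show "norm (fourier_series L \<gamma> S n \<rho> z - of_real (\<rho> z)) \<le> C / real n ^ m"
      using C[OF n box] by simp
  qed
qed

text \<open>Exponent 1 suffices here. The necessity of padding rests on pointwise convergence alone,
  so insufficient padding rules out even that.\<close>

lemma spectrally_accurate_imp_tendsto:
  assumes "spectrally_accurate_on X f g" "z \<in> X"
  shows "(\<lambda>n. f n z) \<longlonglongrightarrow> of_real (g z)"
proof -
  obtain C where C: "\<And>n z. n \<ge> 1 \<Longrightarrow> z \<in> X \<Longrightarrow> norm (f n z - of_real (g z)) \<le> C / real n ^ 1"
    using assms(1) unfolding spectrally_accurate_on_def by meson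
  have "(\<lambda>n. f n z - of_real (g z)) \<longlonglongrightarrow> 0"
  proof (rule Lim_null_comparison)
    show "\<forall>\<^sub>F n in sequentially. norm (f n z - of_real (g z)) \<le> C / real n"
      using eventually_ge_at_top[of 1] by eventually_elim (use C assms(2) in force)
    show "(\<lambda>n. C / real n) \<longlonglongrightarrow> 0"
      by (rule lim_const_over_n)
  qed
  then show ?thesis by (rule LIM_zero_cancel)
qed

text \<open>A point just inside the density box and its translate by one period lie in the extended box
  and share the value of every Fourier series, while a density can be positive at the former
  and vanishes at the latter.\<close>

lemma padded_if_spectrally_accurate:
  fixes \<gamma> S :: "real^'d"
  assumes "L > 0" "\<And>j. \<gamma> $ j > 0" "\<And>j. S $ j \<ge> 1"
    and acc: "\<And>\<rho>. \<rho> \<in> densities L \<gamma> \<Longrightarrow>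
      spectrally_accurate_on (extended_box L \<gamma> j1) (\<lambda>n. fourier_series L \<gamma> S n \<rho>) \<rho>"
  shows "trunc_radius L \<gamma> j1 + L * \<gamma> $ j \<le> (2 * S $ j - 1) * L * \<gamma> $ j"
proof (rule ccontr)
  assume "\<not> ?thesis"
  then have gap: "2 * S $ j * L * \<gamma> $ j < trunc_radius L \<gamma> j1 + 2 * (L * \<gamma> $ j)"
    by (simp add: algebra_simps)
  let ?P = "padded_period L \<gamma> S"
  obtain \<rho> where \<rho>: "\<rho> \<in> densities L \<gamma>" and pos: "\<And>x. (\<And>j. \<bar>x $ j\<bar> < L * \<gamma> $ j) \<Longrightarrow> \<rho> x > 0"
    using exists_density_positive_inside by blast
  have S0: "S $ j > 0" for j
    using assms(3)[of j] by simp
  have Lg: "L * \<gamma> $ j > 0" for j using assms by simp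
  have P: "?P j > 0" for j
    using assms S0 by simp
  have half: "2 * (L * \<gamma> $ j) \<le> ?P j" for j
    using mult_right_mono[OF assms(3)[of j], of "L * \<gamma> $ j"] Lg[of j] by simp
  \<comment> \<open>The second bound keeps \<open>x\<close> on the positive half-axis inside the
    density box. The third gives |y_j| = P_j - L \<gamma>_j + \<delta> < G + L \<gamma>_j, so the
    translate stays in the extended box.\<close>
  obtain \<delta> where \<delta>: "\<delta> > 0" "\<delta> < L * \<gamma> $ j" "\<delta> < trunc_radius L \<gamma> j1 + 2 * (L * \<gamma> $ j) - ?P j"
    using field_lbound_gt_zero[of "L * \<gamma> $ j" "trunc_radius L \<gamma> j1 + 2 * (L * \<gamma> $ j) - ?P j"] gap Lg[of j]
    by auto
  have T0: "trunc_radius L \<gamma> j1 \<ge> 0"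
    using assms(1) by (simp add: trunc_radius_def aniso_root_def sum_nonneg)
  define x :: "real^'d" where "x = axis j (L * \<gamma> $ j - \<delta>)"
  define y :: "real^'d" where "y = axis j (L * \<gamma> $ j - \<delta> - ?P j)"
  have xj: "x $ i = (if i = j then L * \<gamma> $ j - \<delta> else 0)"
    and yj: "y $ i = (if i = j then L * \<gamma> $ j - \<delta> - ?P j else 0)" for i
    by (auto simp: x_def y_def axis_def)
  have "\<rho> x > 0"
    using \<delta> Lg by (intro pos) (auto simp: xj)
  moreover have "\<rho> y = 0"
    using \<delta> half[of j] by (intro density_zero_off_interior[OF \<rho>, where j = j]) (auto simp: yj)
  moreover have "x \<in> extended_box L \<gamma> j1"
    using \<delta> less_imp_le[OF Lg] T0 by (auto simp: extended_box_def xj)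
  moreover have "y \<in> extended_box L \<gamma> j1"
    using \<delta> less_imp_le[OF Lg] T0 half[of j] by (auto simp: extended_box_def yj abs_le_iff)
  moreover have "fourier_series L \<gamma> S n \<rho> x = fourier_series L \<gamma> S n \<rho> y" for n
    by (rule fourier_series_shift, rule less_imp_neq[OF P, symmetric]) (auto simp: xj yj)
  ultimately have "(\<lambda>n. fourier_series L \<gamma> S n \<rho> x) \<longlonglongrightarrow> of_real (\<rho> x)"
      "(\<lambda>n. fourier_series L \<gamma> S n \<rho> x) \<longlonglongrightarrow> of_real 0"
    using spectrally_accurate_imp_tendsto[OF acc[OF \<rho>], of x] spectrally_accurate_imp_tendsto[OF acc[OF \<rho>], of y]
    by auto
  then have "complex_of_real (\<rho> x) = of_real 0" by (rule LIMSEQ_unique)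
  with \<open>\<rho> x > 0\<close> show False by simp
qed

section \<open>Truncated potentials, boxes and memory\<close>

lemma lborel_reflect:
  fixes x :: "'a::euclidean_space"
  shows "distr lborel borel (\<lambda>y. x - y) = lborel"
  using lborel_affine[of "-1" x] by (simp add: density_1)

lemma integrable_lborel_reflect_iff:
  fixes f :: "'a::euclidean_space \<Rightarrow> real"
  shows "integrable lborel (\<lambda>y. f (x - y)) \<longleftrightarrow> integrable lborel f"
proof -
  have imp: "integrable lborel (\<lambda>y. g (x - y))" if "integrable lborel g" for g :: "'a \<Rightarrow> real"
    using integrable_distr[of "\<lambda>y. x - y" lborel borel g] that by (simp add: lborel_reflect)
  show ?thesis using imp[of f] imp[of "\<lambda>y. f (x - y)"] by auto
qed

text \<open>When \<open>f\<close> is not integrable, neither is its reflection, and both integrals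
  take the default value 0; the identity thus covers singular kernels.\<close>

lemma integral_lborel_reflect:
  fixes f :: "'a::euclidean_space \<Rightarrow> real"
  shows "(LINT y|lborel. f (x - y)) = (LINT y|lborel. f y)"
proof (cases "integrable lborel f")
  case True
  then have "f \<in> borel_measurable borel" by simp
  then have "(LINT y|distr lborel borel (\<lambda>y. x - y). f y) = (LINT y|lborel. f (x - y))"
    by (intro integral_distr) auto
  then show ?thesis by (simp add: lborel_reflect)
next
  case False
  then show ?thesis
    using integrable_lborel_reflect_iff[of f x] by (simp add: not_integrable_integral_eq)
qed

text \<open>Wherever the density is nonzero at \<open>y\<close>, both \<open>x\<close> and
  \<open>y\<close> lie in the box and their distance is at most its diameter, so the cutoff changes
  nothing. The equivalence of integrability shows that the equality is not an artefact of default
  values.\<close>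

lemma potential_eq_truncated_potential:
  fixes \<gamma> :: "real^'d"
  assumes \<rho>: "\<rho> \<in> densities L \<gamma>" and x: "x \<in> density_box L \<gamma>" and G: "diameter (density_box L \<gamma>) \<le> G"
  shows "integrable lborel (\<lambda>y. U (x - y) * \<rho> y) \<longleftrightarrow>
      set_integrable lborel (cball 0 G) (\<lambda>y. U y * \<rho> (x - y))"
    and "potential U \<rho> x = truncated_potential G U \<rho> x"
proof -
  define f where "f = (\<lambda>y. indicator (cball 0 G) y *\<^sub>R (U y * \<rho> (x - y)))"
  have f: "f (x - y) = U (x - y) * \<rho> y" for y
  proof (cases "\<rho> y = 0")
    case False
    then have "y \<in> density_box L \<gamma>"
      using density_zero_outside[OF \<rho>] by blast
    then have "norm (x - y) \<le> G"
      using diameter_bounded_bound[OF compact_imp_bounded[OF compact_density_box] x] G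
      by (fastforce simp: dist_norm)
    then show ?thesis by (simp add: f_def)
  qed (simp add: f_def)
  show "integrable lborel (\<lambda>y. U (x - y) * \<rho> y) \<longleftrightarrow>
      set_integrable lborel (cball 0 G) (\<lambda>y. U y * \<rho> (x - y))"
    using integrable_lborel_reflect_iff[of f x] unfolding f by (simp add: set_integrable_def f_def)
  show "potential U \<rho> x = truncated_potential G U \<rho> x"
    using integral_lborel_reflect[of f x] unfolding f
    by (simp add: potential_def truncated_potential_def set_lebesgue_integral_def f_def)
qed

section \<open>Diameter, extended box and anisotropy\<close>

lemma aniso_root_eq_norm:
  assumes "\<gamma> $ j1 = 1"
  shows "aniso_root \<gamma> j1 = norm \<gamma>"
proof -
  have "(\<Sum>j\<in>UNIV. (\<gamma> $ j)\<^sup>2) = (\<gamma> $ j1)\<^sup>2 + (\<Sum>j\<in>UNIV - {j1}. (\<gamma> $ j)\<^sup>2)"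
    by (rule sum.remove) auto
  then show ?thesis using assms by (simp add: aniso_root_def norm_vec_def L2_set_def)
qed

lemma diameter_density_box:
  fixes \<gamma> :: "real^'d"
  assumes "L \<ge> 0" "\<And>j. \<gamma> $ j \<ge> 0"
  shows "diameter (density_box L \<gamma>) = 2 * L * norm \<gamma>"
proof -
  have "\<forall>i\<in>Basis. - (L *\<^sub>R \<gamma>) \<bullet> i \<le> (L *\<^sub>R \<gamma>) \<bullet> i"
    using assms by (auto simp: Basis_vec_def inner_axis)
  then have "diameter (density_box L \<gamma>) = norm (- (L *\<^sub>R \<gamma>) - L *\<^sub>R \<gamma>)"
    unfolding density_box_eq_cbox dist_norm[symmetric] by (rule diameter_cbox)
  also have "- (L *\<^sub>R \<gamma>) - L *\<^sub>R \<gamma> = (- (2 * L)) *\<^sub>R \<gamma>"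
    by (simp add: vec_eq_iff)
  finally show ?thesis using assms by simp
qed

lemma difference_subset_extended_box:
  fixes \<gamma> :: "real^'d"
  shows "{x - y | x y. x \<in> density_box L \<gamma> \<and> y \<in> cball 0 (trunc_radius L \<gamma> j1)} \<subseteq> extended_box L \<gamma> j1"
proof clarify
  fix x y :: "real^'d"
  assume x: "x \<in> density_box L \<gamma>" and y: "y \<in> cball 0 (trunc_radius L \<gamma> j1)"
  have "\<bar>(x - y) $ j\<bar> \<le> trunc_radius L \<gamma> j1 + L * \<gamma> $ j" for j
  proof -
    have "\<bar>x $ j\<bar> \<le> L * \<gamma> $ j" using x by (simp add: density_box_def)
    moreover have "\<bar>y $ j\<bar> \<le> trunc_radius L \<gamma> j1"
      using y component_le_norm_cart[of y j] by simp
    ultimately show ?thesis by (simp add: abs_le_iff)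
  qed
  then show "x - y \<in> extended_box L \<gamma> j1" by (simp add: extended_box_def)
qed

text \<open>The difference set is in general a box with rounded corners, yet it attains the extreme
  values of every coordinate, and an enclosing box is determined by these.\<close>

lemma extended_box_least_cbox:
  fixes \<gamma> :: "real^'d"
  assumes "L \<ge> 0" "\<And>j. \<gamma> $ j \<ge> 0"
    and sub: "{x - y | x y. x \<in> density_box L \<gamma> \<and> y \<in> cball 0 (trunc_radius L \<gamma> j1)} \<subseteq> cbox a b"
  shows "extended_box L \<gamma> j1 \<subseteq> cbox a b"
proof
  fix z assume z: "z \<in> extended_box L \<gamma> j1"
  let ?G = "trunc_radius L \<gamma> j1"
  have G: "?G \<ge> 0"
    using assms(1) by (simp add: trunc_radius_def aniso_root_def sum_nonneg)
  have "a $ j \<le> z $ j \<and> z $ j \<le> b $ j" for j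
  proof -
    \<comment> \<open>The sign \<open>c\<close> selects a corner of the density box and a pole of
      the ball so that coordinate \<open>j\<close> of the difference is
      \<open>c * (?G + L * \<gamma> $ j)\<close>.\<close>
    have mem: "(c * L) *\<^sub>R \<gamma> - (- c * ?G) *\<^sub>R axis j 1 \<in> cbox a b" if "c = 1 \<or> c = -1" for c
    proof -
      have "(c * L) *\<^sub>R \<gamma> \<in> density_box L \<gamma>"
        using that assms by (auto simp: density_box_def)
      moreover have "(- c * ?G) *\<^sub>R axis j 1 \<in> cball (0 :: real^'d) ?G"
        using that G by auto
      ultimately show ?thesis using sub by blast
    qed
    have "((c * L) *\<^sub>R \<gamma> - (- c * ?G) *\<^sub>R axis j 1) $ j = c * (?G + L * \<gamma> $ j)" for c
      by (simp add: algebra_simps)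
    then have "a $ j \<le> - (?G + L * \<gamma> $ j)" "?G + L * \<gamma> $ j \<le> b $ j"
      using mem[of 1] mem[of "-1"] unfolding mem_box_cart by (metis mult_minus1 mult_1)+
    moreover have "\<bar>z $ j\<bar> \<le> ?G + L * \<gamma> $ j"
      using z by (simp add: extended_box_def)
    ultimately show ?thesis by linarith
  qed
  then show "z \<in> cbox a b" by (simp add: mem_box_cart)
qed

lemma padding_condition_iff:
  assumes "L > 0" "\<gamma> $ j > 0"
  shows "trunc_radius L \<gamma> j1 + L * \<gamma> $ j \<le> (2 * S $ j - 1) * L * \<gamma> $ j
     \<longleftrightarrow> 1 + inverse (\<gamma> $ j) * aniso_root \<gamma> j1 \<le> S $ j"
proof -
  let ?r = "aniso_root \<gamma> j1"
  have "trunc_radius L \<gamma> j1 + L * \<gamma> $ j \<le> (2 * S $ j - 1) * L * \<gamma> $ j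
      \<longleftrightarrow> (2 * L) * (?r + \<gamma> $ j) \<le> (2 * L) * (S $ j * \<gamma> $ j)"
    by (simp add: trunc_radius_def algebra_simps)
  also have "\<dots> \<longleftrightarrow> ?r + \<gamma> $ j \<le> S $ j * \<gamma> $ j"
    using assms by (simp only: mult_le_cancel_left_pos)
  also have "\<dots> \<longleftrightarrow> (?r + \<gamma> $ j) / \<gamma> $ j \<le> S $ j"
    using assms by (simp only: pos_divide_le_eq)
  also have "(?r + \<gamma> $ j) / \<gamma> $ j = 1 + inverse (\<gamma> $ j) * ?r"
    using assms by (simp add: field_simps)
  finally show ?thesis .
qed

text \<open>All factors of the product are at least 1, so a product equal to 1 leaves no room for
  any of them to exceed 1.\<close>

lemma aniso_strength_one_imp:
  assumes "aniso_strength \<gamma> = 1" "\<And>j. 0 < \<gamma> $ j" "\<And>j. \<gamma> $ j \<le> 1"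
  shows "\<gamma> $ j = 1"
proof -
  have "(\<Prod>i\<in>UNIV - {j}. inverse (\<gamma> $ i)) \<ge> 1"
    using assms by (intro prod_ge_1) (simp add: one_le_inverse)
  moreover have "aniso_strength \<gamma> = inverse (\<gamma> $ j) * (\<Prod>i\<in>UNIV - {j}. inverse (\<gamma> $ i))"
    unfolding aniso_strength_def by (rule prod.remove) auto
  ultimately have "inverse (\<gamma> $ j) * 1 \<le> 1"
    using assms(1) mult_left_mono[of 1 "\<Prod>i\<in>UNIV - {j}. inverse (\<gamma> $ i)" "inverse (\<gamma> $ j)"]
      less_imp_le[OF assms(2)[of j]] by simp
  then have "1 \<le> \<gamma> $ j"
    using assms(2)[of j] by (simp add: field_simps)
  with assms(3)[of j] show ?thesis by simp
qed

section \<open>Counting stored grid values\<close>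

lemma inj_on_grid_point:
  fixes \<gamma> S :: "real^'d"
  assumes "\<And>j. padded_period L \<gamma> S j > 0"
  shows "inj_on (grid_point L \<gamma> S n) (grid_indices S n)"
proof (rule inj_onI)
  fix p q assume pq: "p \<in> grid_indices S n" "q \<in> grid_indices S n" "grid_point L \<gamma> S n p = grid_point L \<gamma> S n q"
  show "p = q"
  proof
    fix j
    have "p j < num_points S n j"
      using pq(1) by (simp add: grid_indices_def)
    then have "num_points S n j > 0" by simp
    moreover have "grid_point L \<gamma> S n p $ j = grid_point L \<gamma> S n q $ j"
      using pq(3) by simp
    then have "padded_period L \<gamma> S j * real (p j) / real (num_points S n j)
        = padded_period L \<gamma> S j * real (q j) / real (num_points S n j)"
      unfolding grid_point_nth node_def by linarith
    ultimately show "p j = q j"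
      using assms[of j] by auto
  qed
qed

lemma memory_cost_eq_prod:
  fixes \<gamma> S :: "real^'d"
  assumes "\<And>j. padded_period L \<gamma> S j > 0"
  shows "memory_cost L \<gamma> S n = (\<Prod>j\<in>UNIV. num_points S n j)"
  unfolding memory_cost_def grid_def
  using card_image[OF inj_on_grid_point[where n = n, OF assms]]
  by (simp add: grid_indices_eq_PiE card_PiE)

text \<open>For integral factors nothing is rounded, so the ratio of memory costs is the product of
  the factors for every \<open>n \<ge> 1\<close>, not only asymptotically.\<close>

lemma num_points_of_int:
  assumes "S $ j = of_int k" "k \<ge> 0"
  shows "num_points S n j = nat k * n"
proof -
  have "S $ j * real n = of_int (k * int n)" using assms by simp
  then have "\<lceil>S $ j * real n\<rceil> = k * int n" by (simp only: ceiling_of_int)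
  then show ?thesis using assms by (simp add: num_points_def nat_mult_distrib)
qed

text \<open>By the two directions of the padding criterion, the admissible factors are exactly the
  vectors lying coordinatewise above \<open>opt_padding\<close>. Such a set has its corner as
  simultaneous minimum, and its integral members have the rounded-up corner. The number of points is
  monotone in each factor, so least memory follows from optimality in every direction.\<close>

theorem mainTheorem2:
  fixes L :: real and \<gamma> :: "real^'d" and j1 :: 'd and U :: "real^'d \<Rightarrow> real"
  assumes "L > 0"
    and "CARD('d) \<in> {1, 2, 3}"
    and "\<gamma> $ j1 = 1"
    and "\<forall>j. j \<noteq> j1 \<longrightarrow> 0 < \<gamma> $ j \<and> \<gamma> $ j \<le> 1"
  shows
    "trunc_radius L \<gamma> j1 = diameter (density_box L \<gamma>)
     \<and> (\<forall>\<rho>\<in>densities L \<gamma>. \<forall>x\<in>density_box L \<gamma>.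
          (integrable lborel (\<lambda>y. U (x - y) * \<rho> y) \<longleftrightarrow>
             set_integrable lborel (cball 0 (trunc_radius L \<gamma> j1)) (\<lambda>y. U y * \<rho> (x - y))) \<and>
          potential U \<rho> x = truncated_potential (trunc_radius L \<gamma> j1) U \<rho> x)
     \<and> {x - y | x y. x \<in> density_box L \<gamma> \<and> y \<in> cball 0 (trunc_radius L \<gamma> j1)}
          \<subseteq> extended_box L \<gamma> j1
     \<and> (\<forall>a b. {x - y | x y. x \<in> density_box L \<gamma> \<and> y \<in> cball 0 (trunc_radius L \<gamma> j1)} \<subseteq> cbox a b
          \<longrightarrow> extended_box L \<gamma> j1 \<subseteq> cbox a b)
     \<and> (\<forall>S :: real^'d. \<forall>j.
          trunc_radius L \<gamma> j1 + L * \<gamma> $ j \<le> (2 * S $ j - 1) * L * \<gamma> $ j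
            \<longleftrightarrow> 1 + inverse (\<gamma> $ j) * aniso_root \<gamma> j1 \<le> S $ j)
     \<and> (\<forall>S. (\<forall>j. S $ j \<ge> 1) \<longrightarrow>
          (S \<in> admissible_paddings L \<gamma> j1 \<longleftrightarrow>
            (\<forall>j. trunc_radius L \<gamma> j1 + L * \<gamma> $ j \<le> (2 * S $ j - 1) * L * \<gamma> $ j)))
     \<and> is_optimal_in (admissible_paddings L \<gamma> j1) (opt_padding \<gamma> j1)
     \<and> (aniso_strength \<gamma> = 1 \<longrightarrow> (\<forall>j. opt_padding \<gamma> j1 $ j = sqrt (real CARD('d)) + 1))
     \<and> is_optimal_in (admissible_paddings L \<gamma> j1 \<inter> integral_paddings) (ceil_padding \<gamma> j1)
     \<and> (\<forall>n\<ge>1.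
          real (memory_cost L \<gamma> (ceil_padding \<gamma> j1) n)
            = (\<Prod>j\<in>UNIV. of_int \<lceil>opt_padding \<gamma> j1 $ j\<rceil>) * real (memory_cost L \<gamma> 1 n)
          \<and> (\<forall>S\<in>admissible_paddings L \<gamma> j1 \<inter> integral_paddings.
               memory_cost L \<gamma> (ceil_padding \<gamma> j1) n \<le> memory_cost L \<gamma> S n))"
proof -
  let ?G = "trunc_radius L \<gamma> j1"
  let ?S = "opt_padding \<gamma> j1"
  let ?C = "ceil_padding \<gamma> j1"
  let ?A = "admissible_paddings L \<gamma> j1"
  have L: "L > 0" by fact
  have g0: "\<gamma> $ j > 0" and g1: "\<gamma> $ j \<le> 1" for j
    using assms(3,4) by (cases "j = j1"; simp)+
  have g0': "\<gamma> $ j \<ge> 0" for j using g0[of j] by simp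
  have diam: "?G = diameter (density_box L \<gamma>)"
    using diameter_density_box[of L \<gamma>] L g0' by (simp add: trunc_radius_def aniso_root_eq_norm[OF assms(3)])
  have cond_iff: "?G + L * \<gamma> $ j \<le> (2 * S $ j - 1) * L * \<gamma> $ j \<longleftrightarrow> ?S $ j \<le> S $ j" for S j
    using padding_condition_iff[OF L g0, of j1 j S] by (simp add: opt_padding_def)
  have adm_iff: "S \<in> ?A \<longleftrightarrow> (\<forall>j. ?G + L * \<gamma> $ j \<le> (2 * S $ j - 1) * L * \<gamma> $ j)"
    if "\<forall>j. S $ j \<ge> 1" for S
    using that padded_if_spectrally_accurate[OF L g0, of S j1] spectrally_accurate_if_padded[OF L g0, of S _ j1]
    unfolding admissible_paddings_def by blast
  have adm_ge1: "S $ j \<ge> 1" if "S \<in> ?A" for S j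
    using that by (simp add: admissible_paddings_def)
  have adm_ge: "?S $ j \<le> S $ j" if "S \<in> ?A" for S j
    using that adm_iff[of S] adm_ge1[OF that] cond_iff by blast
  have S1: "?S $ j \<ge> 1" for j
    using g0'[of j] by (simp add: opt_padding_def aniso_root_def sum_nonneg)
  have admI: "S \<in> ?A" if "\<And>j. ?S $ j \<le> S $ j" for S
    using that adm_iff[of S] cond_iff[of _ S] S1 order_trans by blast
  have opt: "is_optimal_in ?A ?S"
    using admI[of ?S] adm_ge by (auto simp: is_optimal_in_def)
  have C: "?C $ j = of_int \<lceil>?S $ j\<rceil>" for j
    by (simp add: ceil_padding_def)
  have C1: "\<lceil>?S $ j\<rceil> \<ge> 1" for j
    using S1[of j] by linarith
  have C_adm: "?C \<in> ?A \<inter> integral_paddings"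
    by (auto intro!: admI simp: C integral_paddings_def)
  have C_le: "\<lceil>?S $ j\<rceil> \<le> k" if "S \<in> ?A" "S $ j = of_int k" for S j k
    using adm_ge[OF that(1), of j] that(2) by (simp add: ceiling_le_iff)
  have C_opt: "is_optimal_in (?A \<inter> integral_paddings) ?C"
    unfolding is_optimal_in_def
  proof (intro conjI ballI allI)
    fix T j assume T: "T \<in> ?A \<inter> integral_paddings"
    then have "T $ j \<in> \<int>" by (simp add: integral_paddings_def)
    then obtain k where "T $ j = of_int k" by (rule Ints_cases)
    then show "?C $ j \<le> T $ j"
      using C_le[of T j k] T by (simp add: C)
  qed (rule C_adm)
  have iso: "?S $ j = sqrt (real CARD('d)) + 1" if "aniso_strength \<gamma> = 1" for j
  proof -
    have "\<gamma> $ i = 1" for i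
      using aniso_strength_one_imp[OF that g0 g1] .
    then have "aniso_root \<gamma> j1 = sqrt (real CARD('d))" "inverse (\<gamma> $ j) = 1"
      by (simp_all add: aniso_root_eq_norm norm_vec_def L2_set_def)
    then show ?thesis by (simp add: opt_padding_def)
  qed
  have period: "padded_period L \<gamma> S j > 0" if "\<And>j. S $ j \<ge> 1" for S j
    using L g0[of j] that[of j] by (simp add: less_le_trans[OF zero_less_one])
  have memory: "memory_cost L \<gamma> S n = (\<Prod>j\<in>UNIV. num_points S n j)" if "\<And>j. S $ j \<ge> 1" for S n
    by (rule memory_cost_eq_prod) (rule period[OF that])
  have C_num: "num_points ?C n j = nat \<lceil>?S $ j\<rceil> * n" for n j
    using C1[of j] by (intro num_points_of_int) (auto simp: C)
  have C_ge1: "?C $ j \<ge> 1" for j using C1[of j] by (simp add: C)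
  have cost: "real (memory_cost L \<gamma> ?C n)
      = (\<Prod>j\<in>UNIV. of_int \<lceil>?S $ j\<rceil>) * real (memory_cost L \<gamma> 1 n)" for n
  proof -
    have "num_points 1 n j = n" for j :: 'd
      using num_points_of_int[of 1 j 1 n] by simp
    then have "memory_cost L \<gamma> 1 n = (\<Prod>j\<in>(UNIV :: 'd set). n)"
      using memory[of 1 n] by simp
    moreover have "real (nat \<lceil>?S $ j\<rceil>) = of_int \<lceil>?S $ j\<rceil>" for j
      using C1[of j] by simp
    ultimately show ?thesis
      by (simp add: memory[OF C_ge1] C_num prod.distrib del: prod_constant)
  qed
  have least: "memory_cost L \<gamma> ?C n \<le> memory_cost L \<gamma> S n" if "S \<in> ?A \<inter> integral_paddings" for S n
  proof -
    have SA: "S \<in> ?A" using that by simp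
    have "num_points ?C n j \<le> num_points S n j" for j
    proof -
      have "S $ j \<in> \<int>" using that by (simp add: integral_paddings_def)
      then obtain k where k: "S $ j = of_int k" by (rule Ints_cases)
      have le: "\<lceil>?S $ j\<rceil> \<le> k" by (rule C_le[OF SA k])
      then have "num_points S n j = nat k * n"
        using C1[of j] by (intro num_points_of_int[OF k]) linarith
      then show ?thesis
        unfolding C_num using nat_mono[OF le] by (simp only: mult_le_mono1)
    qed
    then show ?thesis
      unfolding memory[OF C_ge1] memory[OF adm_ge1[OF SA]] by (intro prod_mono) auto
  qed
  show ?thesis
    apply (intro conjI)
    subgoal by (rule diam)
    subgoal using potential_eq_truncated_potential[of _ L \<gamma> _ ?G U] diam by auto
    subgoal by (rule difference_subset_extended_box)
    subgoal using extended_box_least_cbox[of L \<gamma> j1] L g0' by auto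
    subgoal using padding_condition_iff[OF L g0] by blast
    subgoal using adm_iff by blast
    subgoal by (rule opt)
    subgoal using iso by blast
    subgoal by (rule C_opt)
    subgoal using cost least by blast
    done
qed

end
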